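(* Fix $q\in[0,1]$. Let $\{r(z,u)\}_{z\in\mathbb Z,\,u\ge 0}$ be rate functions with $0\le r(z,u)\le C$ for a constant $C$ independent of $z,u$, and with $u\mapsto r(z,u)$ piecewise continuous for each $z$. Let $s_1,\dots,s_k$ be a finite sequence of transpositions of neighboring integers and let $t\ge 0$. Process 1: start from the configuration $\eta(z)=z$, $z\in\mathbb Z$; apply the asymmetric swaps $W_{s_1,1},W_{s_2,1},\dots,W_{s_k,1}$ (in this order); then run for time $t$ the continuous-time colored ASEP with rates $r(z,u)$. Let $\eta_1$ be the resulting random configuration. Process 2: start from the configuration $\eta(z)=z$, $z\in\mathbb Z$; run for time $t$ the continuous-time colored ASEP with time-reversed rates $\hat r(z,u):=r(z,t-u)$, $0\le u\le t$; then apply the asymmetric swaps $W_{s_k,1},W_{s_{k-1},1},\dots,W_{s_1,1}$ (in this order). Let $\eta_2$ be the resulting random configuration. Then $\eta_1$ and $\eta_2$ are (almost surely) bijections $\mathbb Z\to\mathbb Z$, and $\eta_1$ has the same distribution as $\eta_2^{-1}$, the inverse bijection of $\eta_2$. Equivalently, for any $I\subset\mathbb Z$, the distribution of the colors of the particles at positions in $I$ in Process 1 equals the distribution of the positions of the particles with colors in $I$ in Process 2.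
   Context: A configuration is a map $\eta:\mathbb Z\to\mathbb Z\cup\{+\infty\}$; $\eta(z)$ is the color of the particle at site $z$ (each site holds exactly one particle; color $+\infty$ represents a hole). For $z\in\mathbb Z$ let $\sigma_{(z,z+1)}$ exchange the values $\eta(z)$ and $\eta(z+1)$. For $x\in[0,1]$ the random asymmetric swap $W_{(z,z+1),x}$ maps $\eta$ to: $\sigma_{(z,z+1)}\eta$ with probability $x$ and $\eta$ with probability $1-x$ if $\eta(z)<\eta(z+1)$; $\sigma_{(z,z+1)}\eta$ with probability $qx$ and $\eta$ with probability $1-qx$ if $\eta(z)>\eta(z+1)$; $\eta$ with probability 1 if $\eta(z)=\eta(z+1)$. The continuous-time colored ASEP with rates $r(z,u)$: take independent Poisson processes $\mathcal P(z)$, $z\in\mathbb Z$, on $[0,\infty)$ with (time-inhomogeneous) intensity $r(z,u)$, and at each point of $\mathcal P(z)$ apply $W_{(z,z+1),1}$ (independently) to the current configuration. This is a well-defined process under the stated boundedness assumptions. *)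

theory Defs
  imports "HOL-Probability.Probability"
begin

definition piecewise_continuous :: "(real \<Rightarrow> real) \<Rightarrow> bool" where
  "piecewise_continuous f \<longleftrightarrow>
     (\<forall>T\<ge>0. \<exists>S. finite S \<and> continuous_on ({0..T} - S) f \<and>
        (\<forall>s\<in>S. (\<exists>l. (f \<longlongrightarrow> l) (at s within {0..<s})) \<and>
                (\<exists>l. (f \<longlongrightarrow> l) (at s within {s<..T}))))"

definition poisson_prob :: "real \<Rightarrow> nat \<Rightarrow> real" where
  "poisson_prob lam n = exp (- lam) * lam ^ n / fact n"

text \<open>Intensity measure of the marked Poisson process at site z: time has
intensity rate z u du, marks are uniform (Lebesgue measure; we only evaluate it
on subsets of time x [0,1]).\<close>
definition intensity :: "(int \<Rightarrow> real \<Rightarrow> real) \<Rightarrow> int \<Rightarrow> (real \<times> real) set \<Rightarrow> real" where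
  "intensity rate z A =
     measure (density (lborel \<Otimes>\<^sub>M lborel) (\<lambda>(u, m). ennreal (rate z u))) A"

text \<open>On the probability space M, P z \<omega> is the set of marked points (time, mark)
of the Poisson clock at the edge (z,z+1), and U i \<omega> (i < k) are auxiliary coins.
Restricted to times in [0,T] and marks in [0,1], the family P z (z in Z) is a
family of independent Poisson point processes with intensity rate z u du
(x uniform marks), independent of the i.i.d. uniform[0,1] coins U 0, ..., U (k-1).
This is expressed by the joint law of counts in disjoint Borel sets and the coins.\<close>
definition poisson_family ::
  "'a measure \<Rightarrow> real \<Rightarrow> (int \<Rightarrow> real \<Rightarrow> real) \<Rightarrow> (int \<Rightarrow> 'a \<Rightarrow> (real \<times> real) set)
     \<Rightarrow> nat \<Rightarrow> (nat \<Rightarrow> 'a \<Rightarrow> real) \<Rightarrow> bool" where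
  "poisson_family M T rate P k U \<longleftrightarrow> prob_space M \<and>
     (\<forall>(Z::int set) (J::nat) (A::nat \<Rightarrow> (real \<times> real) set) (n::int \<Rightarrow> nat \<Rightarrow> nat)
        (B::nat \<Rightarrow> real set).
        finite Z \<and> (\<forall>j<J. A j \<in> sets (lborel \<Otimes>\<^sub>M lborel) \<and> A j \<subseteq> {0..T} \<times> {0..1})
        \<and> disjoint_family_on A {..<J} \<and> (\<forall>i<k. B i \<in> sets borel) \<longrightarrow>
        (let E = {\<omega> \<in> space M.
                   (\<forall>z\<in>Z. \<forall>j<J. finite (P z \<omega> \<inter> A j) \<and> card (P z \<omega> \<inter> A j) = n z j)
                   \<and> (\<forall>i<k. U i \<omega> \<in> B i)}
         in E \<in> sets M \<and>
            measure M E = (\<Prod>z\<in>Z. \<Prod>j<J. poisson_prob (intensity rate z (A j)) (n z j))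
                          * (\<Prod>i<k. measure lborel (B i \<inter> {0..1}))))"

text \<open>Configurations: colors of particles at sites (all colors are integers
here, since we start from the identity configuration).\<close>
type_synonym config = "int \<Rightarrow> int"

text \<open>The random swap W_{(z,z+1),1} realised by a coin m uniform on [0,1]:
swap with probability 1 if eta z < eta (z+1), with probability q (m < q)
if eta z > eta (z+1), no change if equal.\<close>
definition swap_step :: "real \<Rightarrow> int \<Rightarrow> real \<Rightarrow> config \<Rightarrow> config" where
  "swap_step q z m \<eta> =
     (if \<eta> z < \<eta> (z + 1) \<or> (\<eta> (z + 1) < \<eta> z \<and> m < q)
      then \<eta>(z := \<eta> (z + 1), z + 1 := \<eta> z) else \<eta>)"

definition apply_swaps :: "real \<Rightarrow> int list \<Rightarrow> real list \<Rightarrow> config \<Rightarrow> config" where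
  "apply_swaps q ss cs \<eta> = foldl (\<lambda>\<xi> (s, c). swap_step q s c \<xi>) \<eta> (zip ss cs)"

definition evs :: "(int \<Rightarrow> (real \<times> real) set) \<Rightarrow> real \<Rightarrow> int \<Rightarrow> (real \<times> real) set" where
  "evs P T z = {(u, m) \<in> P z. 0 \<le> u \<and> u \<le> T \<and> 0 \<le> m \<and> m \<le> 1}"

definition isolated :: "(int \<Rightarrow> (real \<times> real) set) \<Rightarrow> real \<Rightarrow> int \<Rightarrow> int \<Rightarrow> bool" where
  "isolated P T a b \<longleftrightarrow> a \<le> b \<and> evs P T (a - 1) = {} \<and> evs P T b = {} \<and>
     (\<forall>z. a \<le> z \<and> z < b \<longrightarrow> finite (evs P T z))"

text \<open>Rings inside a block, sorted by time (ties, which have probability zero,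
are broken lexicographically by edge, then mark, via stable sorting, so the
resulting list is canonical).\<close>
definition block_events :: "(int \<Rightarrow> (real \<times> real) set) \<Rightarrow> real \<Rightarrow> int \<Rightarrow> int \<Rightarrow> (real \<times> int \<times> real) list" where
  "block_events P T a b =
     sort_key fst (sort_key (\<lambda>e. fst (snd e)) (sort_key (\<lambda>e. snd (snd e))
       (SOME xs. distinct xs \<and>
          set xs = {(u, z, m). a \<le> z \<and> z < b \<and> (u, m) \<in> evs P T z})))"

definition run_block :: "real \<Rightarrow> (int \<Rightarrow> (real \<times> real) set) \<Rightarrow> real \<Rightarrow> int \<Rightarrow> int \<Rightarrow> config \<Rightarrow> config" where
  "run_block q P T a b \<xi> = foldl (\<lambda>\<eta> (u, z, m). swap_step q z m \<eta>) \<xi> (block_events P T a b)"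

text \<open>Configuration at time T of the colored ASEP started from \<xi>, driven by the
marked clocks P (graphical construction). Outside the almost-sure event where every
site lies in an isolated block we return \<xi> (irrelevant).\<close>
definition asep :: "real \<Rightarrow> (int \<Rightarrow> (real \<times> real) set) \<Rightarrow> real \<Rightarrow> config \<Rightarrow> config" where
  "asep q P T \<xi> x =
     (if \<exists>a b. a \<le> x \<and> x \<le> b \<and> isolated P T a b
      then (case SOME (a, b). a \<le> x \<and> x \<le> b \<and> isolated P T a b of
              (a, b) \<Rightarrow> run_block q P T a b \<xi> x)
      else \<xi> x)"

definition process1 :: "real \<Rightarrow> real \<Rightarrow> int list \<Rightarrow> (int \<Rightarrow> 'a \<Rightarrow> (real \<times> real) set)
     \<Rightarrow> (nat \<Rightarrow> 'a \<Rightarrow> real) \<Rightarrow> 'a \<Rightarrow> config" where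
  "process1 q t ss P U \<omega> =
     asep q (\<lambda>z. P z \<omega>) t (apply_swaps q ss (map (\<lambda>i. U i \<omega>) [0..<length ss]) id)"

definition process2 :: "real \<Rightarrow> real \<Rightarrow> int list \<Rightarrow> (int \<Rightarrow> 'a \<Rightarrow> (real \<times> real) set)
     \<Rightarrow> (nat \<Rightarrow> 'a \<Rightarrow> real) \<Rightarrow> 'a \<Rightarrow> config" where
  "process2 q t ss P U \<omega> =
     apply_swaps q (rev ss) (map (\<lambda>i. U i \<omega>) [0..<length ss]) (asep q (\<lambda>z. P z \<omega>) t id)"

definition config_space :: "config measure" where
  "config_space = PiM UNIV (\<lambda>_. count_space UNIV)"

end

theory Submission
  imports Defs "HOL-Combinatorics.Transposition"
begin

text \<open>A swap performed at positions commutes in law with a swap performed at colors: either they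
concern disjoint pairs of particles, or they concern the same pair and are then the same random map.
On the identity configuration both kinds coincide, so a random product of swaps started from the
identity has the law of the inverse of the reversed product.

Space is cut at edges whose clock does not ring, time is cut into \<open>O(N)\<close> cells of length at most
\<open>1 / N\<close>. Up to an event of small probability there is at most one ring per cell in a large window, and
both processes are then random products of swaps with weights that are exchanged by time reversal.\<close>

section \<open>Asymmetric swaps and the Hecke algebra\<close>

text \<open>Averaging over the coins turns each swap into an operator on observables, and time
  reversal becomes an identity between products of such operators, evaluated at the identity
  configuration. Three obstacles shape the remainder. \<open>poisson_family\<close> prescribes only
  the joint law of the coins and of counts in finitely many disjoint Borel sets, so every event,
  including those in the measurability of the processes, has to be built from countably many counts.
  The inverse of process 2 at one site looks at the whole line; it becomes local because a block
  between two silent edges is mapped onto itself. Finally, \<open>r\<close> is unconstrained at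
  negative times, which the reversed rate reads for \<open>u\<close> beyond \<open>t\<close>, while
  \<open>intensity\<close> uses a density on the whole plane that may then fail to be measurable.
  The degenerate case is carried along, and reflection shows that it occurs for both processes or
  for neither.\<close>

abbreviation adj :: "int \<Rightarrow> int \<Rightarrow> int" where
  "adj z \<equiv> Transposition.transpose z (z + 1)"

text \<open>The coin is reduced to the outcome of the test m < q, and the update is a composition
  with a transposition, so that inverses and products of permutations can be computed.\<close>

definition bswap :: "int \<Rightarrow> bool \<Rightarrow> config \<Rightarrow> config" where
  "bswap z b \<eta> = (if \<eta> z < \<eta> (z + 1) \<or> (\<eta> (z + 1) < \<eta> z \<and> b)
     then \<eta> \<circ> adj z else \<eta>)"

lemma swap_step_eq_bswap: "swap_step q z m = bswap z (m < q)"
  by (intro ext) (auto simp: swap_step_def bswap_def Transposition.transpose_def fun_upd_def)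

lemma bij_bswap: "bij \<eta> \<Longrightarrow> bij (bswap z b \<eta>)"
  by (auto simp: bswap_def intro!: bij_comp)

lemma bswap_bij:
  assumes "bij \<eta>"
  shows "bswap z b \<eta> = (if \<eta> z < \<eta> (z + 1) \<or> b then \<eta> \<circ> adj z else \<eta>)"
proof -
  have "\<eta> z \<noteq> \<eta> (z + 1)"
    using assms by (metis bij_def inj_eq add_cancel_left_right zero_neq_one)
  then show ?thesis by (auto simp: bswap_def)
qed

text \<open>The swap of the colors \<open>z\<close> and \<open>z + 1\<close>, as opposed to the sites.\<close>
definition lswap :: "int \<Rightarrow> bool \<Rightarrow> config \<Rightarrow> config" where
  "lswap z b \<eta> = inv (bswap z b (inv \<eta>))"

lemma lswap_bij:
  assumes "bij \<eta>"
  shows "lswap z b \<eta> =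
    (if inv \<eta> z < inv \<eta> (z + 1) \<or> b then adj z \<circ> \<eta> else \<eta>)"
  using assms
  by (auto simp: lswap_def bswap_bij bij_imp_bij_inv o_inv_distrib inv_inv_eq)

text \<open>No integer lies strictly between s and s + 1, so exchanging the two can only affect the
  comparison of these two with each other.\<close>

lemma transpose_adjacent_less_iff:
  fixes x y s :: int
  assumes "{x, y} \<noteq> {s, s + 1}"
  shows "adj s x < adj s y \<longleftrightarrow> x < y"
  using assms by (auto simp: Transposition.transpose_def)

text \<open>The transpositions multiply \<eta> from opposite sides and therefore always commute.
  What needs care is that neither swap changes the comparison on which the other depends; by
  \<open>transpose_adjacent_less_iff\<close> this could happen only if the particles at s, s + 1
  were those of colors t, t + 1.\<close>

lemma lswap_bswap_commute:
  assumes "bij \<eta>" and ne: "{\<eta> s, \<eta> (s + 1)} \<noteq> {t, t + 1}"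
  shows "lswap t b' (bswap s b \<eta>) = bswap s b (lswap t b' \<eta>)"
proof -
  have inv_at: "inv \<eta> x = y \<longleftrightarrow> x = \<eta> y" for x y
    using \<open>bij \<eta>\<close> by (metis bij_inv_eq_iff)
  have ne': "{inv \<eta> t, inv \<eta> (t + 1)} \<noteq> {s, s + 1}"
    using ne by (auto simp: doubleton_eq_iff inv_at)
  have bs: "bij (\<eta> \<circ> adj s)" and bt: "bij (adj t \<circ> \<eta>)"
    using \<open>bij \<eta>\<close> by (auto intro!: bij_comp)
  have 1: "inv (\<eta> \<circ> adj s) t < inv (\<eta> \<circ> adj s) (t + 1)
      \<longleftrightarrow> inv \<eta> t < inv \<eta> (t + 1)"
    using transpose_adjacent_less_iff[OF ne'] \<open>bij \<eta>\<close> by (simp add: o_inv_distrib)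
  have 2: "(adj t \<circ> \<eta>) s < (adj t \<circ> \<eta>) (s + 1)
      \<longleftrightarrow> \<eta> s < \<eta> (s + 1)"
    using transpose_adjacent_less_iff[OF ne] by simp
  have 3: "bswap s b \<eta> = (if \<eta> s < \<eta> (s + 1) \<or> b then \<eta> \<circ> adj s else \<eta>)"
    by (rule bswap_bij[OF \<open>bij \<eta>\<close>])
  have 4: "lswap t b' \<eta> = (if inv \<eta> t < inv \<eta> (t + 1) \<or> b' then adj t \<circ> \<eta> else \<eta>)"
    by (rule lswap_bij[OF \<open>bij \<eta>\<close>])
  show ?thesis
    unfolding 3 4
    using lswap_bij[OF bs, of t b'] bswap_bij[OF bt, of s b] 1 2 3 4
    by (auto simp: o_assoc)
qed

text \<open>Exchanging the only two particles concerned is the same permutation from either side,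
  and these particles are in increasing order as seen from the sites iff they are so as seen from
  the colors. Hence the coin is consulted in the same cases.\<close>

lemma lswap_eq_bswap:
  assumes "bij \<eta>" and eq: "{\<eta> s, \<eta> (s + 1)} = {t, t + 1}"
  shows "lswap t b \<eta> = bswap s b \<eta>"
proof -
  have inv_at: "inv \<eta> x = y \<longleftrightarrow> x = \<eta> y" for x y
    using \<open>bij \<eta>\<close> by (metis bij_inv_eq_iff)
  have inj: "\<eta> x = \<eta> y \<longleftrightarrow> x = y" for x y
    using \<open>bij \<eta>\<close> by (simp add: bij_def inj_eq)
  consider (a) "\<eta> s = t" "\<eta> (s + 1) = t + 1" | (b) "\<eta> s = t + 1" "\<eta> (s + 1) = t"
    using eq by (auto simp: doubleton_eq_iff)
  then show ?thesis
  proof cases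
    case a
    then have "inv \<eta> t = s" "inv \<eta> (t + 1) = s + 1" by (auto simp: inv_at)
    moreover have "adj t \<circ> \<eta> = \<eta> \<circ> adj s"
    proof
      fix x
      show "(adj t \<circ> \<eta>) x = (\<eta> \<circ> adj s) x"
        using inj[of x s] inj[of x "s + 1"] a by (auto simp: Transposition.transpose_def)
    qed
    ultimately show ?thesis using a by (simp add: bswap_bij lswap_bij \<open>bij \<eta>\<close>)
  next
    case b
    then have "inv \<eta> t = s + 1" "inv \<eta> (t + 1) = s" by (auto simp: inv_at)
    moreover have "adj t \<circ> \<eta> = \<eta> \<circ> adj s"
    proof
      fix x
      show "(adj t \<circ> \<eta>) x = (\<eta> \<circ> adj s) x"
        using inj[of x s] inj[of x "s + 1"] b by (auto simp: Transposition.transpose_def)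
    qed
    ultimately show ?thesis using b by (simp add: bswap_bij lswap_bij \<open>bij \<eta>\<close>)
  qed
qed

text \<open>In the identity the sites s, s + 1 carry the colors s, s + 1, for every s. This is where
  the initial configuration enters.\<close>

lemma lswap_id: "lswap s b id = bswap s b id"
  by (rule lswap_eq_bswap) auto

section \<open>Averaged swaps of sites and of colors as operators on observables\<close>

definition swapR :: "real \<Rightarrow> int \<Rightarrow> (config \<Rightarrow> real) \<Rightarrow> config \<Rightarrow> real" where
  "swapR q z f \<eta> = q * f (bswap z True \<eta>) + (1 - q) * f (bswap z False \<eta>)"

definition swapL :: "real \<Rightarrow> int \<Rightarrow> (config \<Rightarrow> real) \<Rightarrow> config \<Rightarrow> real" where
  "swapL q z f \<eta> = q * f (lswap z True \<eta>) + (1 - q) * f (lswap z False \<eta>)"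

text \<open>When both swaps concern the same pair, the two orders of execution use the two coins in
  opposite order, so the maps commute only after averaging. Swapping keeps the pair at s, s + 1,
  hence both sides become \<open>swapR\<close> applied twice.\<close>

lemma swapR_swapL_commute:
  assumes "bij \<eta>"
  shows "swapR q s (swapL q t f) \<eta> = swapL q t (swapR q s f) \<eta>"
proof (cases "{\<eta> s, \<eta> (s + 1)} = {t, t + 1}")
  case False
  then show ?thesis
    using assms by (simp add: swapR_def swapL_def lswap_bswap_commute algebra_simps)
next
  case True
  have "swapL q t f (bswap s b \<eta>) = swapR q s f (bswap s b \<eta>)" for b
  proof -
    have "{bswap s b \<eta> s, bswap s b \<eta> (s + 1)} = {t, t + 1}"
      using True by (auto simp: bswap_def Transposition.transpose_def)
    then show ?thesis
      by (simp add: swapR_def swapL_def lswap_eq_bswap[OF bij_bswap[OF assms]])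
  qed
  then show ?thesis
    using lswap_eq_bswap[OF assms True] by (simp add: swapR_def swapL_def)
qed

text \<open>One step that performs at most one swap, the option naming the edge. The outermost
  operator of a product is the earliest step in time. The weights may sum to less than one: the
  deficit of a time cell will be the probability of several rings in it. R and L name the side from
  which the transposition multiplies.\<close>

definition opR :: "real \<Rightarrow> int set \<Rightarrow> (int option \<Rightarrow> real) \<Rightarrow> (config \<Rightarrow> real) \<Rightarrow> config \<Rightarrow> real" where
  "opR q Z a f \<eta> = a None * f \<eta> + (\<Sum>z\<in>Z. a (Some z) * swapR q z f \<eta>)"

definition opL :: "real \<Rightarrow> int set \<Rightarrow> (int option \<Rightarrow> real) \<Rightarrow> (config \<Rightarrow> real) \<Rightarrow> config \<Rightarrow> real" where
  "opL q Z a f \<eta> = a None * f \<eta> + (\<Sum>z\<in>Z. a (Some z) * swapL q z f \<eta>)"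

lemma opR_opL_commute:
  assumes "bij \<eta>"
  shows "opR q Z a (opL q Z b f) \<eta> = opL q Z b (opR q Z a f) \<eta>"
proof -
  have R: "swapR q z (opL q Z b f) \<eta> =
      b None * swapR q z f \<eta> + (\<Sum>t\<in>Z. b (Some t) * swapR q z (swapL q t f) \<eta>)" for z
    by (simp add: swapR_def opL_def algebra_simps sum_distrib_left sum.distrib sum_subtractf)
  have L: "swapL q t (opR q Z a f) \<eta> =
      a None * swapL q t f \<eta> + (\<Sum>z\<in>Z. a (Some z) * swapL q t (swapR q z f) \<eta>)" for t
    by (simp add: swapL_def opR_def algebra_simps sum_distrib_left sum.distrib sum_subtractf)
  have "(\<Sum>z\<in>Z. \<Sum>t\<in>Z. a (Some z) * (b (Some t) * swapR q z (swapL q t f) \<eta>)) =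
      (\<Sum>t\<in>Z. \<Sum>z\<in>Z. b (Some t) * (a (Some z) * swapL q t (swapR q z f) \<eta>))"
    by (subst sum.swap) (simp add: swapR_swapL_commute[OF assms] mult_ac)
  then show ?thesis
    unfolding opR_def[of q Z a "opL q Z b f"] opL_def[of q Z b "opR q Z a f"] R L
    by (simp add: opR_def opL_def distrib_left sum.distrib sum_distrib_left mult_ac)
qed

text \<open>Sites and colors play symmetric roles only for bijections. Swaps preserve bijectivity,
  so observables have to be compared at bijections only.\<close>

lemma opR_cong:
  assumes "bij \<eta>" "\<And>\<xi>. bij \<xi> \<Longrightarrow> f \<xi> = g \<xi>"
  shows "opR q Z a f \<eta> = opR q Z a g \<eta>"
  using assms by (simp add: opR_def swapR_def bij_bswap)

lemma foldr_opR_cong: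
  assumes "\<And>\<xi>. bij \<xi> \<Longrightarrow> f \<xi> = g \<xi>" "bij \<eta>"
  shows "foldr (opR q Z) as f \<eta> = foldr (opR q Z) as g \<eta>"
  using \<open>bij \<eta>\<close> by (induction as arbitrary: \<eta>) (auto intro!: opR_cong assms(1))

lemma foldr_opR_opL_commute:
  assumes "bij \<eta>"
  shows "foldr (opR q Z) as (opL q Z b f) \<eta> = opL q Z b (foldr (opR q Z) as f) \<eta>"
  using assms
proof (induction as arbitrary: \<eta>)
  case (Cons a as)
  have "foldr (opR q Z) (a # as) (opL q Z b f) \<eta> =
      opR q Z a (opL q Z b (foldr (opR q Z) as f)) \<eta>"
    using Cons by (auto intro!: opR_cong)
  then show ?case using Cons.prems by (simp add: opR_opL_commute)
qed simp

lemma opR_id_eq_opL: "opR q Z a f id = opL q Z a f id"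
  by (simp add: opR_def opL_def swapR_def swapL_def lswap_id)

lemma opR_comp_inv:
  assumes "bij \<eta>"
  shows "opR q Z a (f \<circ> inv) \<eta> = (opL q Z a f \<circ> inv) \<eta>"
  using assms by (simp add: opR_def opL_def swapR_def swapL_def lswap_def inv_inv_eq)

text \<open>The anti-involution \<open>T_w \<mapsto> T_{w\<inverse>}\<close> of the Hecke algebra in probabilistic form.\<close>
lemma foldr_opR_rev:
  "foldr (opR q Z) (rev as) (f \<circ> inv) id = foldr (opR q Z) as f id"
proof (induction as arbitrary: f)
  case (Cons a as)
  \<comment> \<open>In the reversed product \<open>a\<close> acts last. Inversion turns it into a
    color swap, which is absorbed into the observable for the induction hypothesis, then moved
    outwards past all site swaps, and at the identity read as a site swap again, now acting
    first.\<close>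
  have "foldr (opR q Z) (rev (a # as)) (f \<circ> inv) id =
      foldr (opR q Z) (rev as) (opL q Z a f \<circ> inv) id"
    by (simp, rule foldr_opR_cong) (simp_all add: opR_comp_inv)
  also have "\<dots> = opL q Z a (foldr (opR q Z) as f) id"
    by (rule trans[OF Cons.IH foldr_opR_opL_commute[OF bij_id]])
  also have "\<dots> = foldr (opR q Z) (a # as) f id"
    unfolding opR_id_eq_opL[symmetric] by simp
  finally show ?case .
qed simp

section \<open>Words of swaps and their locality\<close>

definition run_word :: "(int \<times> bool) list \<Rightarrow> config \<Rightarrow> config" where
  "run_word = fold (\<lambda>(z, b). bswap z b)"

lemma run_word_simps [simp]:
  "run_word [] \<xi> = \<xi>"
  "run_word ((z, b) # w) \<xi> = run_word w (bswap z b \<xi>)"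
  "run_word (w @ w') \<xi> = run_word w' (run_word w \<xi>)"
  by (auto simp: run_word_def)

lemma bij_run_word: "bij \<xi> \<Longrightarrow> bij (run_word w \<xi>)"
  by (induction w arbitrary: \<xi>) (auto simp: bij_bswap)

lemma apply_swaps_eq_run_word:
  "apply_swaps q ss cs \<xi> = run_word (zip ss (map (\<lambda>c. c < q) cs)) \<xi>"
  unfolding apply_swaps_def
proof (induction ss arbitrary: cs \<xi>)
  case (Cons s ss)
  then show ?case by (cases cs) (auto simp: swap_step_eq_bswap)
qed simp

lemma run_block_eq_run_word:
  "run_block q P T a b \<xi> = run_word (map (\<lambda>(u, z, m). (z, m < q)) (block_events P T a b)) \<xi>"
proof -
  have "foldl (\<lambda>\<eta> (u, z, m). swap_step q z m \<eta>) \<xi> xs =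
      run_word (map (\<lambda>(u, z, m). (z, m < q)) xs) \<xi>" for xs
    by (induction xs arbitrary: \<xi>) (auto simp: swap_step_eq_bswap)
  then show ?thesis by (simp add: run_block_def)
qed

text \<open>No letter crosses the edges a - 1 and b, so a letter outside the block moves no particle
  of the block, and a letter inside it compares only particles of the block. The two initial
  configurations may differ elsewhere.\<close>

lemma run_word_agree:
  assumes "\<forall>(z, c)\<in>set w. z \<noteq> a - 1 \<and> z \<noteq> b"
    and "\<forall>x\<in>{a..b}. \<xi> x = \<xi>' x" and "x \<in> {a..b}"
  shows "run_word w \<xi> x = run_word (filter (\<lambda>(z, c). a \<le> z \<and> z < b) w) \<xi>' x"
  using assms
proof (induction w arbitrary: \<xi> \<xi>')
  case (Cons e w)
  obtain z c where e: "e = (z, c)" by fastforce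
  show ?case
  proof (cases "a \<le> z \<and> z < b")
    case True
    then have "\<forall>x\<in>{a..b}. bswap z c \<xi> x = bswap z c \<xi>' x"
      using Cons.prems(2) by (auto simp: bswap_def Transposition.transpose_def)
    from Cons.IH[OF _ this Cons.prems(3)] show ?thesis
      using True Cons.prems(1) by (simp add: e)
  next
    case False
    then have "z + 1 < a \<or> b < z" using Cons.prems(1) by (auto simp: e)
    then have "\<forall>x\<in>{a..b}. bswap z c \<xi> x = \<xi>' x"
      using Cons.prems(2) by (auto simp: bswap_def Transposition.transpose_def)
    from Cons.IH[OF _ this Cons.prems(3)] show ?thesis
      using False Cons.prems(1) by (auto simp add: e)
  qed
qed simp

text \<open>Each letter composes with a permutation of the sites that preserves the block. This is
  what makes inverse configurations computable inside a block.\<close>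

lemma run_word_image:
  assumes "\<forall>(z, c)\<in>set w. z \<noteq> a - 1 \<and> z \<noteq> b"
  shows "run_word w \<xi> ` {a..b} = \<xi> ` {a..b}"
  using assms
proof (induction w arbitrary: \<xi>)
  case (Cons e w)
  obtain z c where e: "e = (z, c)" by fastforce
  have "adj z ` {a..b} = {a..b}"
  proof (cases "a \<le> z \<and> z < b")
    case False
    then have "z + 1 < a \<or> b < z" using Cons.prems by (auto simp: e)
    then show ?thesis by (auto simp: Transposition.transpose_def image_iff)
  qed (simp add: transpose_image_eq)
  then have "(\<xi> \<circ> adj z) ` {a..b} = \<xi> ` {a..b}"
    by (simp only: image_comp[symmetric])
  then have "bswap z c \<xi> ` {a..b} = \<xi> ` {a..b}"
    by (simp only: bswap_def split: if_split) simp
  then show ?case using Cons by (simp add: e)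
qed simp

section \<open>The graphical construction on isolated blocks\<close>

text \<open>The lexicographic order of \<open>block_events\<close> in strict form: a list sorted by
  a strict order is free of repetitions and determined by its set of elements.\<close>

definition before :: "real \<times> int \<times> real \<Rightarrow> real \<times> int \<times> real \<Rightarrow> bool" where
  "before e f \<longleftrightarrow> fst e < fst f \<or> fst e = fst f \<and>
     (fst (snd e) < fst (snd f) \<or> fst (snd e) = fst (snd f) \<and> snd (snd e) < snd (snd f))"

lemma before_irrefl: "\<not> before e e" and before_trans: "before e f \<Longrightarrow> before f g \<Longrightarrow> before e g"
  and before_linear: "e \<noteq> f \<Longrightarrow> before e f \<or> before f e"
  by (auto simp: before_def prod_eq_iff)

lemma sorted_wrt_unique:
  assumes irrefl: "\<And>x. \<not> R x x" and trans: "\<And>x y z. R x y \<Longrightarrow> R y z \<Longrightarrow> R x z"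
    and "sorted_wrt R xs" "sorted_wrt R ys" "set xs = set ys"
  shows "xs = ys"
  using assms(3-5)
proof (induction xs arbitrary: ys)
  case (Cons x xs)
  then obtain y ys' where ys: "ys = y # ys'" by (cases ys) auto
  have "x = y"
  proof (rule ccontr)
    assume "x \<noteq> y"
    then have "x \<in> set ys'" "y \<in> set xs" using Cons.prems(3) by (auto simp: ys)
    then have "R x y" "R y x" using Cons.prems by (auto simp: ys)
    then show False using irrefl trans by blast
  qed
  moreover have "x \<notin> set xs" "y \<notin> set ys'"
    using Cons.prems irrefl by (auto simp: ys)
  then have "set xs = set ys'" using Cons.prems(3) \<open>x = y\<close> by (auto simp: ys)
  ultimately show ?case using Cons by (auto simp: ys)
qed simp

text \<open>Stability of the sort: an element is inserted in front of those with an equal key, and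
  the second premise says that it preceded them in the original order.\<close>

lemma sorted_wrt_insort_key:
  assumes "sorted_wrt (\<lambda>x y. f x < f y \<or> f x = f y \<and> R x y) ys" "\<forall>y\<in>set ys. R x y"
  shows "sorted_wrt (\<lambda>x y. f x < f y \<or> f x = f y \<and> R x y) (insort_key f x ys)"
  using assms by (induction ys) (auto simp: set_insort_key)

lemma sorted_wrt_sort_key:
  fixes f :: "'b \<Rightarrow> 'c :: linorder"
  assumes "sorted_wrt R xs"
  shows "sorted_wrt (\<lambda>x y. f x < f y \<or> f x = f y \<and> R x y) (sort_key f xs)"
  using assms by (induction xs) (auto intro!: sorted_wrt_insort_key)

text \<open>Replaces the arbitrary enumeration inside \<open>block_events\<close> by a function of
  the set of rings alone, which can be compared between a window and a block and between rings and
  their discretisations.\<close>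

definition ordered_list :: "(real \<times> int \<times> real) set \<Rightarrow> (real \<times> int \<times> real) list" where
  "ordered_list S = (THE xs. sorted_wrt before xs \<and> set xs = S)"

definition block_points :: "(int \<Rightarrow> (real \<times> real) set) \<Rightarrow> real \<Rightarrow> int \<Rightarrow> int \<Rightarrow> (real \<times> int \<times> real) set" where
  "block_points P T a b = {(u, z, m). a \<le> z \<and> z < b \<and> (u, m) \<in> evs P T z}"

lemma ordered_list_eqI:
  assumes "sorted_wrt before xs" "set xs = S"
  shows "ordered_list S = xs"
  unfolding ordered_list_def
  by (rule the_equality)
    (use assms sorted_wrt_unique[of before _ xs] before_irrefl before_trans in \<open>blast+\<close>)

lemma sorted_block_events:
  assumes "finite (block_points P T a b)"
  shows "sorted_wrt before (block_events P T a b) \<and> set (block_events P T a b) = block_points P T a b"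
proof -
  define xs where "xs = (SOME xs. distinct xs \<and> set xs = block_points P T a b)"
  have "\<exists>xs. distinct xs \<and> set xs = block_points P T a b"
    using finite_distinct_list[OF assms] by blast
  from someI_ex[OF this] have xs: "distinct xs" "set xs = block_points P T a b"
    by (auto simp: xs_def)
  \<comment> \<open>A list without repetitions is sorted by \<noteq>. Each stable pass puts one more
    key in front of the relation, and after three passes it implies \<open>before\<close>.\<close>
  then have "sorted_wrt (\<noteq>) xs"
    by (auto simp: distinct_conv_nth sorted_wrt_iff_nth_less)
  from sorted_wrt_sort_key[where f = fst, OF sorted_wrt_sort_key[where f = "\<lambda>e. fst (snd e)",
      OF sorted_wrt_sort_key[where f = "\<lambda>e. snd (snd e)", OF this]]]
  have "sorted_wrt before (sort_key fst (sort_key (\<lambda>e. fst (snd e)) (sort_key (\<lambda>e. snd (snd e)) xs)))"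
    by (rule sorted_wrt_mono_rel[rotated]) (auto simp: before_def)
  then show ?thesis
    using xs by (simp add: block_events_def xs_def block_points_def)
qed

lemma block_events_eq:
  "finite (block_points P T a b) \<Longrightarrow> block_events P T a b = ordered_list (block_points P T a b)"
  using ordered_list_eqI sorted_block_events by metis

lemma sorted_ordered_list:
  assumes "finite S"
  shows "sorted_wrt before (ordered_list S)" "set (ordered_list S) = S"
proof -
  have "\<exists>xs. sorted_wrt before xs \<and> set xs = S"
    using assms
  proof (induction S)
    case (insert e S)
    then obtain xs where xs: "sorted_wrt before xs" "set xs = S" by blast
    have "sorted_wrt before (filter (\<lambda>f. before f e) xs @ e # filter (before e) xs)"
      using xs by (auto simp: sorted_wrt_append sorted_wrt_filter intro: before_trans)
    moreover have "set (filter (\<lambda>f. before f e) xs @ e # filter (before e) xs) = insert e S"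
      using xs insert.hyps before_linear[of _ e] by (auto simp del: split_paired_All)
    ultimately show ?case by blast
  qed auto
  then show "sorted_wrt before (ordered_list S)" "set (ordered_list S) = S"
    using ordered_list_eqI by metis+
qed

lemma ordered_list_filter:
  assumes "finite S"
  shows "filter p (ordered_list S) = ordered_list {e \<in> S. p e}"
  by (rule ordered_list_eqI[symmetric])
    (use sorted_ordered_list[OF assms] in \<open>auto simp: sorted_wrt_filter\<close>)

lemma ordered_list_map:
  assumes "finite S" "\<And>e f. e \<in> S \<Longrightarrow> f \<in> S \<Longrightarrow> before e f \<Longrightarrow> before (g e) (g f)"
  shows "ordered_list (g ` S) = map g (ordered_list S)"
proof (rule ordered_list_eqI)
  show "sorted_wrt before (map g (ordered_list S))"
    unfolding sorted_wrt_map
    using sorted_ordered_list[OF assms(1)] assms(2) by (auto intro: sorted_wrt_mono_rel[rotated])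
qed (use sorted_ordered_list[OF assms(1)] in auto)

definition block_word :: "real \<Rightarrow> (int \<Rightarrow> (real \<times> real) set) \<Rightarrow> real \<Rightarrow> int \<Rightarrow> int \<Rightarrow> (int \<times> bool) list" where
  "block_word q P T a b = map (\<lambda>(u, z, m). (z, m < q)) (block_events P T a b)"

lemma run_block_eq: "run_block q P T a b \<xi> = run_word (block_word q P T a b) \<xi>"
  by (simp add: run_block_eq_run_word block_word_def)

lemma finite_block_points:
  assumes "\<And>z. a \<le> z \<Longrightarrow> z < b \<Longrightarrow> finite (evs P T z)"
  shows "finite (block_points P T a b)"
proof -
  have "block_points P T a b = (\<Union>z\<in>{a..<b}. (\<lambda>(u, m). (u, z, m)) ` evs P T z)"
    by (auto simp: block_points_def)
  then show ?thesis using assms by auto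
qed

text \<open>The canonical order is compatible with filtering, so the word of the block is the word
  of the window with the outer letters removed. Silence is asked of the two edges bounding the
  block; those bounding the window may ring.\<close>

lemma run_word_restrict:
  assumes fin: "finite (block_points P T lo hi)" and sub: "lo \<le> a" "b \<le> hi"
    and empty: "evs P T (a - 1) = {}" "evs P T b = {}" and x: "x \<in> {a..b}"
  shows "run_word (block_word q P T lo hi) \<xi> x = run_word (block_word q P T a b) \<xi> x"
proof -
  have eq: "block_points P T a b = {e \<in> block_points P T lo hi. a \<le> fst (snd e) \<and> fst (snd e) < b}"
    using sub by (auto simp: block_points_def)
  then have fin': "finite (block_points P T a b)" using fin by auto
  have "block_events P T a b =
      filter (\<lambda>e. a \<le> fst (snd e) \<and> fst (snd e) < b) (block_events P T lo hi)"
    by (simp add: block_events_eq fin fin' ordered_list_filter eq)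
  then have filter: "block_word q P T a b =
      filter (\<lambda>(z, c). a \<le> z \<and> z < b) (block_word q P T lo hi)"
    by (simp add: block_word_def filter_map o_def case_prod_beta)
  have "\<forall>(z, c)\<in>set (block_word q P T lo hi). z \<noteq> a - 1 \<and> z \<noteq> b"
    using empty sorted_block_events[OF fin] by (auto simp: block_word_def block_points_def)
  from run_word_agree[OF this _ x, of \<xi> \<xi>] show ?thesis by (simp add: filter)
qed

lemma block_word_image:
  assumes fin: "finite (block_points P T lo hi)"
    and empty: "evs P T (a - 1) = {}" "evs P T b = {}"
  shows "run_word (block_word q P T lo hi) \<xi> ` {a..b} = \<xi> ` {a..b}"
proof (rule run_word_image)
  show "\<forall>(z, c)\<in>set (block_word q P T lo hi). z \<noteq> a - 1 \<and> z \<noteq> b"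
    using empty sorted_block_events[OF fin] by (auto simp: block_word_def block_points_def)
qed

lemma isolated_finite: "isolated P T a b \<Longrightarrow> finite (block_points P T a b)"
  by (rule finite_block_points) (auto simp: isolated_def)

lemma isolated_hull:
  assumes "isolated P T a b" "isolated P T a' b'" "{a..b} \<inter> {a'..b'} \<noteq> {}"
  shows "isolated P T (min a a') (max b b')"
proof -
  have "a \<le> b'" "a' \<le> b" using assms by (auto simp: isolated_def)
  then have "finite (evs P T z)" if "min a a' \<le> z" "z < max b b'" for z
    using that assms(1,2) unfolding isolated_def by (smt (verit, best))
  then show ?thesis
    using assms(1,2) by (auto simp: isolated_def min_def max_def)
qed

text \<open>\<open>asep\<close> uses an unspecified isolated block around the site. Any two such
  blocks overlap, so their hull is isolated too, and both are restrictions of it.\<close>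

lemma isolated_run_agree:
  assumes "isolated P T a b" "isolated P T a' b'" "x \<in> {a..b}" "x \<in> {a'..b'}"
  shows "run_word (block_word q P T a b) \<xi> x = run_word (block_word q P T a' b') \<xi> x"
proof -
  have "isolated P T (min a a') (max b b')"
    using assms by (intro isolated_hull) auto
  note fin = isolated_finite[OF this]
  show ?thesis
    using run_word_restrict[OF fin, of a b x q \<xi>] run_word_restrict[OF fin, of a' b' x q \<xi>] assms
    by (simp add: isolated_def)
qed

lemma asep_isolated:
  assumes "isolated P T a b" "x \<in> {a..b}"
  shows "asep q P T \<xi> x = run_word (block_word q P T a b) \<xi> x"
proof -
  define c where "c = (SOME (a, b). a \<le> x \<and> x \<le> b \<and> isolated P T a b)"
  have ex: "\<exists>a b. a \<le> x \<and> x \<le> b \<and> isolated P T a b" using assms by auto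
  then have "\<exists>c. case c of (a, b) \<Rightarrow> a \<le> x \<and> x \<le> b \<and> isolated P T a b" by auto
  from someI_ex[OF this] have c: "fst c \<le> x" "x \<le> snd c" "isolated P T (fst c) (snd c)"
    by (auto simp: c_def split: prod.splits)
  have "asep q P T \<xi> x = run_word (block_word q P T (fst c) (snd c)) \<xi> x"
    using ex by (simp add: asep_def c_def run_block_eq case_prod_beta)
  also have "\<dots> = run_word (block_word q P T a b) \<xi> x"
    by (rule isolated_run_agree) (use assms c in auto)
  finally show ?thesis .
qed

lemma asep_not_isolated:
  assumes "\<not> (\<exists>a b. isolated P T a b \<and> x \<in> {a..b})"
  shows "asep q P T \<xi> x = \<xi> x"
  using assms by (auto simp: asep_def)

lemma asep_image:
  assumes "isolated P T a b"
  shows "asep q P T \<xi> ` {a..b} = \<xi> ` {a..b}"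
proof -
  have "asep q P T \<xi> ` {a..b} = run_word (block_word q P T a b) \<xi> ` {a..b}"
    using asep_isolated[OF assms] by (intro image_cong) auto
  also have "\<dots> = \<xi> ` {a..b}"
    using assms by (intro block_word_image isolated_finite) (auto simp: isolated_def)
  finally show ?thesis .
qed

text \<open>True for every realization of the clocks, not only almost surely. Isolated blocks
  permute their contents and uncovered sites keep their color. If x and y receive the same color,
  that color sits under \<xi> at a site w in the block of x and also in any block of y, so the
  blocks overlap and the hull contains x and y; if y is uncovered, then y = w, which is
  absurd.\<close>

lemma bij_asep:
  assumes "bij \<xi>"
  shows "bij (asep q P T \<xi>)"
proof (rule bijI)
  have inj_block: "x = y"
    if "isolated P T a b" "x \<in> {a..b}" "y \<in> {a..b}" "asep q P T \<xi> x = asep q P T \<xi> y" for a b x y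
    using that bij_run_word[OF assms] by (auto simp: asep_isolated bij_def inj_eq)
  have aux: "x = y"
    if iso: "isolated P T a b" "x \<in> {a..b}" and eq: "asep q P T \<xi> x = asep q P T \<xi> y" for a b x y
  proof -
    have "asep q P T \<xi> y \<in> \<xi> ` {a..b}"
      using asep_image[OF iso(1), of q \<xi>] iso(2) eq by (metis imageI)
    then obtain w where w: "w \<in> {a..b}" "asep q P T \<xi> y = \<xi> w" by auto
    show ?thesis
    proof (cases "\<exists>a' b'. isolated P T a' b' \<and> y \<in> {a'..b'}")
      case True
      then obtain a' b' where iso': "isolated P T a' b'" "y \<in> {a'..b'}" by blast
      have "\<xi> w \<in> \<xi> ` {a'..b'}"
        using asep_image[OF iso'(1), of q \<xi>] iso'(2) w(2) by (metis imageI)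
      then have "w \<in> {a'..b'}" using assms by (auto simp: bij_def inj_eq)
      then have "isolated P T (min a a') (max b b')"
        using w iso iso' by (intro isolated_hull) auto
      then show ?thesis
        by (rule inj_block) (use iso iso' eq in auto)
    next
      case False
      then have "\<xi> y = \<xi> w" using w asep_not_isolated by metis
      then have "y = w" using assms by (auto simp: bij_def inj_eq)
      then show ?thesis using False iso(1) w by blast
    qed
  qed
  show "inj (asep q P T \<xi>)"
  proof (rule injI)
    fix x y assume eq: "asep q P T \<xi> x = asep q P T \<xi> y"
    show "x = y"
    proof (cases "\<exists>a b. isolated P T a b \<and> (x \<in> {a..b} \<or> y \<in> {a..b})")
      case True
      then show ?thesis using aux eq by metis
    next
      case False
      then have "\<xi> x = \<xi> y" using eq asep_not_isolated by metis
      then show ?thesis using assms by (auto simp: bij_def inj_eq)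
    qed
  qed
  show "surj (asep q P T \<xi>)"
  unfolding surj_def
  proof
    fix y
    obtain x where x: "y = \<xi> x" using assms by (metis bij_pointE)
    show "\<exists>x. y = asep q P T \<xi> x"
    proof (cases "\<exists>a b. isolated P T a b \<and> x \<in> {a..b}")
      case True
      then obtain a b where "isolated P T a b" "x \<in> {a..b}" by blast
      then show ?thesis using asep_image[of P T a b q \<xi>] x by (metis imageE imageI)
    next
      case False
      then show ?thesis using asep_not_isolated x by metis
    qed
  qed
qed

lemma asep_window:
  assumes fin: "finite (block_points P T lo hi)" and "lo \<le> a" "b \<le> hi" "a \<le> b"
    and empty: "evs P T (a - 1) = {}" "evs P T b = {}" and x: "x \<in> {a..b}"
  shows "asep q P T \<xi> x = run_word (block_word q P T lo hi) \<xi> x"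
proof -
  have "finite (evs P T z)" if "a \<le> z" "z < b" for z
  proof -
    have "(\<lambda>(u, m). (u, z, m)) ` evs P T z \<subseteq> block_points P T lo hi"
      using that assms(2,3) by (auto simp: block_points_def)
    then have "finite ((\<lambda>(u, m). (u, z, m)) ` evs P T z)" using fin finite_subset by blast
    then show ?thesis by (rule finite_imageD) (auto simp: inj_on_def)
  qed
  then have "isolated P T a b" using assms by (simp add: isolated_def)
  then show ?thesis
    using run_word_restrict[OF fin assms(2,3) empty x] asep_isolated x by metis
qed

section \<open>The intensity measure\<close>

text \<open>Holds for arbitrary f: the integral is a supremum over simple functions below f, and
  only these are transported along R. This gives one inequality; applied to the composition of f
  with R it gives the other.\<close>

lemma nn_integral_involution:
  assumes R: "R \<in> M \<rightarrow>\<^sub>M M" "distr M M R = M" "\<And>x. R (R x) = x"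
  shows "(\<integral>\<^sup>+x. f (R x) \<partial>M) = (\<integral>\<^sup>+x. f x \<partial>M)"
proof -
  have le: "(\<integral>\<^sup>+x. f x \<partial>M) \<le> (\<integral>\<^sup>+x. f (R x) \<partial>M)" for f
    unfolding nn_integral_def[of M f]
  proof (rule SUP_least)
    fix g assume "g \<in> {g. simple_function M g \<and> g \<le> f}"
    then have g: "simple_function M g" "\<And>x. g x \<le> f x" by (auto simp: le_fun_def)
    then have meas: "g \<in> borel_measurable M" by (intro borel_measurable_simple_function)
    have "integral\<^sup>S M g = (\<integral>\<^sup>+x. g x \<partial>distr M M R)"
      using g(1) R(2) by (simp add: nn_integral_eq_simple_integral)
    also have "\<dots> = (\<integral>\<^sup>+x. g (R x) \<partial>M)"
      using R(1) meas by (simp add: nn_integral_distr)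
    also have "\<dots> \<le> (\<integral>\<^sup>+x. f (R x) \<partial>M)"
      by (intro nn_integral_mono g)
    finally show "integral\<^sup>S M g \<le> (\<integral>\<^sup>+x. f (R x) \<partial>M)" .
  qed
  show ?thesis
    using le[of f] le[of "\<lambda>x. f (R x)"] R(3) by simp
qed

text \<open>A density need not be measurable: \<^const>\<open>density\<close> then is the null measure unless the
lower integrals happen to be countably additive.\<close>
definition is_density :: "'a measure \<Rightarrow> ('a \<Rightarrow> ennreal) \<Rightarrow> bool" where
  "is_density M f \<longleftrightarrow> measure_space (space M) (sets M) (\<lambda>A. \<integral>\<^sup>+x. f x * indicator A x \<partial>M)"

lemma emeasure_density_conv:
  assumes "A \<in> sets M"
  shows "emeasure (density M f) A = (if is_density M f then \<integral>\<^sup>+x. f x * indicator A x \<partial>M else 0)"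
  using assms unfolding density_def
  by (subst emeasure_measure_of_conv) (simp add: is_density_def sets.sigma_sets_eq)

text \<open>The set function of the reflected density is the image under R of the original one, so
  countable additivity is inherited.\<close>

lemma is_density_involution:
  assumes R: "R \<in> M \<rightarrow>\<^sub>M M" "distr M M R = M" "\<And>x. R (R x) = x" and f: "is_density M f"
  shows "is_density M (\<lambda>x. f (R x))"
proof -
  define \<mu> where "\<mu> f A = (\<integral>\<^sup>+x. f x * indicator A x \<partial>M)" for f :: "'a \<Rightarrow> ennreal" and A
  have eq: "\<mu> (\<lambda>x. f (R x)) A = \<mu> f (R -` A \<inter> space M)" for A
  proof -
    have "\<mu> (\<lambda>x. f (R x)) A = (\<integral>\<^sup>+x. f (R x) * indicator (R -` A) (R x) \<partial>M)"
      using R(3) by (simp add: \<mu>_def indicator_def)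
    also have "\<dots> = (\<integral>\<^sup>+x. f x * indicator (R -` A) x \<partial>M)"
      by (rule nn_integral_involution[OF R])
    also have "\<dots> = \<mu> f (R -` A \<inter> space M)"
      unfolding \<mu>_def by (rule nn_integral_cong) (auto simp: indicator_def)
    finally show ?thesis .
  qed
  have add: "countably_additive (sets M) (\<mu> f)"
    using f by (simp add: is_density_def measure_space_def \<mu>_def[abs_def])
  have "countably_additive (sets M) (\<mu> (\<lambda>x. f (R x)))"
  proof (rule countably_additiveI)
    fix A :: "nat \<Rightarrow> 'a set" assume A: "range A \<subseteq> sets M" "disjoint_family A" "\<Union> (range A) \<in> sets M"
    have "(\<Sum>i. \<mu> f (R -` A i \<inter> space M)) = \<mu> f (\<Union>i. R -` A i \<inter> space M)"
    proof (rule add[unfolded countably_additive_def, rule_format])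
      show "range (\<lambda>i. R -` A i \<inter> space M) \<subseteq> sets M"
        using A(1) R(1) by (auto intro!: measurable_sets)
      then show "(\<Union>i. R -` A i \<inter> space M) \<in> sets M"
        by (rule sets.countable_UN)
      show "disjoint_family (\<lambda>i. R -` A i \<inter> space M)"
        using A(2) by (fastforce simp: disjoint_family_on_def)
    qed
    also have "(\<Union>i. R -` A i \<inter> space M) = R -` (\<Union> (range A)) \<inter> space M" by auto
    finally show "(\<Sum>i. \<mu> (\<lambda>x. f (R x)) (A i)) = \<mu> (\<lambda>x. f (R x)) (\<Union> (range A))"
      by (simp add: eq)
  qed
  then show ?thesis
    using sets.sigma_algebra_axioms
    by (simp add: is_density_def measure_space_def positive_def \<mu>_def[abs_def])
qed

lemma is_density_involution_iff:
  assumes "R \<in> M \<rightarrow>\<^sub>M M" "distr M M R = M" "\<And>x. R (R x) = x"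
  shows "is_density M (\<lambda>x. f (R x)) \<longleftrightarrow> is_density M f"
  using is_density_involution[OF assms, of f] is_density_involution[OF assms, of "\<lambda>x. f (R x)"]
  by (auto simp: assms(3))

lemma distr_lborel_reflect: "distr lborel lborel (\<lambda>u::real. t - u) = lborel"
proof -
  have "distr lborel borel (\<lambda>u::real. t + (-1) *\<^sub>R u) = lborel"
    using lborel_affine[of "-1::real" t] by (simp add: density_1)
  then show ?thesis by (simp cong: distr_cong)
qed

lemma distr_lborel_pair_reflect:
  "distr (lborel \<Otimes>\<^sub>M lborel) (lborel \<Otimes>\<^sub>M lborel) (\<lambda>(u::real, m::real). (t - u, m)) = lborel \<Otimes>\<^sub>M lborel"
proof -
  have "distr lborel lborel (\<lambda>u::real. t - u) \<Otimes>\<^sub>M distr lborel lborel (\<lambda>m::real. m) =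
      distr (lborel \<Otimes>\<^sub>M lborel) (lborel \<Otimes>\<^sub>M lborel) (\<lambda>(u::real, m::real). (t - u, m))"
    by (rule pair_measure_distr) (auto simp: distr_id2 intro: lborel.sigma_finite_measure_axioms)
  then show ?thesis by (simp add: distr_lborel_reflect distr_id2)
qed

text \<open>The time factor of \<open>intensity\<close>. The case distinction concerns the density
  on the plane, since this is what decides whether \<open>intensity\<close> vanishes
  identically.\<close>

definition mass :: "(int \<Rightarrow> real \<Rightarrow> real) \<Rightarrow> int \<Rightarrow> real set \<Rightarrow> real" where
  "mass rate z B =
     (if is_density (lborel \<Otimes>\<^sub>M lborel) (\<lambda>(u::real, m::real). ennreal (rate z u))
      then enn2real (\<integral>\<^sup>+u. ennreal (rate z u) * indicator B u \<partial>lborel) else 0)"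

lemma mass_nonneg: "0 \<le> mass rate z B"
  by (simp add: mass_def)

lemma mass_reflect: "mass (\<lambda>z u. r z (t - u)) z {u. t - u \<in> B} = mass r z B"
proof -
  have "is_density (lborel \<Otimes>\<^sub>M lborel) (\<lambda>(u::real, m::real). ennreal (r z (t - u))) \<longleftrightarrow>
      is_density (lborel \<Otimes>\<^sub>M lborel) (\<lambda>(u::real, m::real). ennreal (r z u))"
    using is_density_involution_iff[OF _ distr_lborel_pair_reflect[of t],
        of "\<lambda>(u::real, m::real). ennreal (r z u)"]
    by (simp add: case_prod_beta')
  moreover have "(\<integral>\<^sup>+u. ennreal (r z (t - u)) * indicator {u. t - u \<in> B} u \<partial>lborel) =
      (\<integral>\<^sup>+u. ennreal (r z u) * indicator B u \<partial>lborel)"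
    using nn_integral_involution[OF _ distr_lborel_reflect[of t],
        of "\<lambda>u. ennreal (r z u) * indicator B u"]
    by (simp add: indicator_def)
  ultimately show ?thesis by (simp add: mass_def)
qed

text \<open>All conditions refer to the interval [0, T], which the reflection u \<mapsto> T - u
  preserves, so that the forward and the reversed rates are both instances.\<close>

locale rate_bound =
  fixes T C :: real and rate :: "int \<Rightarrow> real \<Rightarrow> real"
  assumes T: "0 \<le> T"
    and rate_measurable: "(\<lambda>u. rate z u * indicator {0..T} u) \<in> borel_measurable borel"
    and rate_bounds: "u \<in> {0..T} \<Longrightarrow> 0 \<le> rate z u \<and> rate z u \<le> C"
begin

lemma C_nonneg: "0 \<le> C"
  using rate_bounds[of 0 0] T by auto

lemma indicator_rate:
  assumes "B \<subseteq> {0..T}"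
  shows "ennreal (rate z u) * indicator B u = ennreal (rate z u * indicator {0..T} u) * indicator B u"
  using assms by (auto simp: indicator_def)

lemma intensity_Times:
  assumes B: "B \<in> sets borel" "B \<subseteq> {0..T}" and J: "J \<in> sets borel"
  shows "intensity rate z (B \<times> J) = mass rate z B * measure lborel J"
proof -
  note [measurable] = rate_measurable B(1) J
  \<comment> \<open>On \<open>B \<times> J\<close> the rate may be multiplied by the indicator of
    [0, T]. The integrand becomes measurable and Tonelli applies, whatever the rate does
    outside.\<close>
  have "(\<integral>\<^sup>+x. (case x of (u, m) \<Rightarrow> ennreal (rate z u)) * indicator (B \<times> J) x \<partial>(lborel \<Otimes>\<^sub>M lborel)) =
      (\<integral>\<^sup>+x. (ennreal (rate z (fst x) * indicator {0..T} (fst x)) * indicator B (fst x))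
         * indicator J (snd x) \<partial>(lborel \<Otimes>\<^sub>M lborel))"
    using B(2) by (intro nn_integral_cong) (auto simp: indicator_def split: prod.splits)
  also have "\<dots> = (\<integral>\<^sup>+u. \<integral>\<^sup>+m. (ennreal (rate z u * indicator {0..T} u) * indicator B u)
         * indicator J m \<partial>lborel \<partial>lborel)"
    by (subst lborel.nn_integral_fst[symmetric]) (auto simp: measurable_lborel1)
  also have "\<dots> = (\<integral>\<^sup>+u. ennreal (rate z u * indicator {0..T} u) * indicator B u \<partial>lborel)
         * emeasure lborel J"
    by (simp add: nn_integral_cmult nn_integral_multc)
  finally have "(\<integral>\<^sup>+x. (case x of (u, m) \<Rightarrow> ennreal (rate z u)) * indicator (B \<times> J) x
      \<partial>(lborel \<Otimes>\<^sub>M lborel)) =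
      (\<integral>\<^sup>+u. ennreal (rate z u) * indicator B u \<partial>lborel) * emeasure lborel J"
    by (simp only: indicator_rate[OF B(2), symmetric])
  then show ?thesis
    using B(1) J
    by (simp add: intensity_def measure_def emeasure_density_conv mass_def enn2real_mult)
qed

lemma mass_le:
  assumes B: "B \<in> sets borel" "B \<subseteq> {0..T}"
  shows "mass rate z B \<le> C * measure lborel B"
proof -
  have fin: "emeasure lborel B < \<infinity>"
    using emeasure_mono[OF B(2), of lborel] T by (auto simp: le_less_trans)
  have "(\<integral>\<^sup>+u. ennreal (rate z u) * indicator B u \<partial>lborel) \<le> (\<integral>\<^sup>+u. ennreal C * indicator B u \<partial>lborel)"
    using B(2) rate_bounds by (intro nn_integral_mono) (auto simp: indicator_def ennreal_leI)
  also have "\<dots> = ennreal (C * measure lborel B)"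
    using B(1) fin C_nonneg by (simp add: nn_integral_cmult_indicator emeasure_eq_ennreal_measure ennreal_mult)
  finally have "enn2real (\<integral>\<^sup>+u. ennreal (rate z u) * indicator B u \<partial>lborel) \<le> C * measure lborel B"
    using C_nonneg by (intro enn2real_leI) auto
  then show ?thesis using C_nonneg by (simp add: mass_def)
qed

end

text \<open>Off a finite set the function is continuous, and changing values at countably many
  points keeps it Borel.\<close>

lemma piecewise_continuous_measurable:
  assumes "piecewise_continuous f" "0 \<le> T"
  shows "(\<lambda>u. f u * indicator {0..T} u) \<in> borel_measurable borel"
proof -
  obtain S where S: "finite S" "continuous_on ({0..T} - S) f"
    using assms unfolding piecewise_continuous_def by blast
  have "{0..T} - S \<in> sets borel" using S(1) by (intro sets.Diff) (auto intro: borel_closed finite_imp_closed)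
  from borel_measurable_continuous_on_indicator[OF this S(2)]
  have "(\<lambda>u. indicator ({0..T} - S) u *\<^sub>R f u) \<in> borel_measurable borel" by simp
  then show ?thesis
    by (rule measurable_discrete_difference[where X = S])
      (use S(1) in \<open>auto simp: indicator_def countable_finite\<close>)
qed

lemma rate_bound_forward:
  assumes "\<forall>z. \<forall>u\<ge>0. 0 \<le> r z u \<and> r z u \<le> C" "\<forall>z. piecewise_continuous (r z)" "0 \<le> t"
  shows "rate_bound t C r"
  using assms by unfold_locales (auto simp: piecewise_continuous_measurable)

lemma rate_bound_reflect:
  assumes "rate_bound t C r"
  shows "rate_bound t C (\<lambda>z u. r z (t - u))"
proof -
  interpret rate_bound t C r by fact
  show ?thesis
  proof
    fix z
    have "(\<lambda>u. r z (t - u) * indicator {0..t} (t - u)) \<in> borel_measurable borel"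
      using rate_measurable[of z] by measurable
    then show "(\<lambda>u. r z (t - u) * indicator {0..t} u) \<in> borel_measurable borel"
      by (rule measurable_cong[THEN iffD1, rotated]) (auto simp: indicator_def)
  qed (use T rate_bounds in auto)
qed

section \<open>Measurability of the process\<close>

text \<open>The shift of the marks below \<open>q\<close> makes the test \<open>m < q\<close> readable from the sign of the
discretised mark without disturbing the order of the marks.\<close>
definition grid_point :: "real \<Rightarrow> nat \<Rightarrow> real \<times> int \<times> real \<Rightarrow> real \<times> int \<times> real" where
  "grid_point q N = (\<lambda>(u, z, m). (of_int \<lfloor>real N * u\<rfloor>, z,
     of_int (if m < q then \<lfloor>real N * m\<rfloor> - int N - 1 else \<lfloor>real N * m\<rfloor>)))"

lemma eventually_floor_less:
  fixes u v :: real
  assumes "u < v"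
  shows "\<forall>\<^sub>F N in sequentially. \<lfloor>real N * u\<rfloor> < \<lfloor>real N * v\<rfloor>"
proof -
  obtain N0 where N0: "1 / (v - u) < real N0" using reals_Archimedean2 by blast
  have "\<lfloor>real N * u\<rfloor> < \<lfloor>real N * v\<rfloor>" if "N0 \<le> N" for N
  proof -
    have "1 / (v - u) \<le> real N" using N0 that by linarith
    then have "real N * u + 1 \<le> real N * v" using assms by (simp add: field_simps)
    then show ?thesis by linarith
  qed
  then show ?thesis unfolding eventually_sequentially by blast
qed

lemma floor_le_of_le:
  fixes u v :: real
  shows "u \<le> v \<Longrightarrow> \<lfloor>real N * u\<rfloor> \<le> \<lfloor>real N * v\<rfloor>"
  by (intro floor_mono mult_left_mono) auto

lemma floor_unit_bounds:
  fixes m :: real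
  assumes "0 \<le> m" "m \<le> 1"
  shows "0 \<le> \<lfloor>real N * m\<rfloor>" "\<lfloor>real N * m\<rfloor> \<le> int N"
  using assms floor_le_of_le[of m 1 N] by auto

lemma grid_point_sign:
  assumes "0 \<le> m" "m \<le> 1"
  shows "snd (snd (grid_point q N (u, z, m))) < 0 \<longleftrightarrow> m < q"
  using floor_unit_bounds[OF assms, of N] by (simp add: grid_point_def)

text \<open>Equal coordinates stay equal, and the first strict inequality survives on fine grids.
  For marks on different sides of q the shift helps: the lower one becomes negative, the upper one
  does not.\<close>

lemma eventually_before_grid_point:
  assumes "before e f" "0 \<le> snd (snd e)" "snd (snd e) \<le> 1" "0 \<le> snd (snd f)" "snd (snd f) \<le> 1"
  shows "\<forall>\<^sub>F N in sequentially. before (grid_point q N e) (grid_point q N f)"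
proof -
  obtain u z m u' z' m' where e: "e = (u, z, m)" and f: "f = (u', z', m')" by (metis prod_cases3)
  consider "u < u'" | "u = u'" "z < z'" | "u = u'" "z = z'" "m < m'"
    using assms(1) by (auto simp: before_def e f)
  then show ?thesis
  proof cases
    case 1
    from eventually_floor_less[OF this] show ?thesis
      by eventually_elim (simp add: before_def grid_point_def e f)
  next
    case 2
    then show ?thesis by (simp add: before_def grid_point_def e f)
  next
    case 3
    from eventually_floor_less[OF 3(3)] show ?thesis
    proof eventually_elim
      case (elim N)
      have "0 \<le> \<lfloor>real N * m\<rfloor>" "\<lfloor>real N * m\<rfloor> \<le> int N" "0 \<le> \<lfloor>real N * m'\<rfloor>" "\<lfloor>real N * m'\<rfloor> \<le> int N"
        using floor_unit_bounds[of m N] floor_unit_bounds[of m' N] assms by (auto simp: e f)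
      then show ?case using elim 3 by (auto simp: before_def grid_point_def e f)
    qed
  qed
qed

definition point_word :: "real \<Rightarrow> (real \<times> int \<times> real) set \<Rightarrow> (int \<times> bool) list" where
  "point_word q S = map (\<lambda>(u, z, m). (z, m < q)) (ordered_list S)"

lemma block_word_eq_point_word:
  "finite (block_points P T a b) \<Longrightarrow> block_word q P T a b = point_word q (block_points P T a b)"
  by (simp add: block_word_def point_word_def block_events_eq)

text \<open>On fine grids the discretisation is strictly increasing on the finite set S, so the
  ordered list is carried over entry by entry. The threshold 0 on the left reads the sign in which m
  < q is stored.\<close>

lemma eventually_point_word_grid:
  assumes "finite S" "\<And>u z m. (u, z, m) \<in> S \<Longrightarrow> 0 \<le> m \<and> m \<le> 1"
  shows "\<forall>\<^sub>F N in sequentially. point_word 0 (grid_point q N ` S) = point_word q S"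
proof -
  have "\<forall>\<^sub>F N in sequentially. \<forall>e\<in>S. \<forall>f\<in>S. before e f \<longrightarrow> before (grid_point q N e) (grid_point q N f)"
    using assms eventually_before_grid_point
    by (intro eventually_ball_finite ballI) (auto simp: eventually_before_grid_point)
  then show ?thesis
  proof eventually_elim
    case (elim N)
    have "point_word 0 (grid_point q N ` S) =
        map ((\<lambda>(u, z, m). (z, m < 0)) \<circ> grid_point q N) (ordered_list S)"
      using elim by (simp add: point_word_def ordered_list_map[OF assms(1)])
    also have "\<dots> = point_word q S"
      unfolding point_word_def
    proof (rule map_cong[OF refl])
      fix e assume "e \<in> set (ordered_list S)"
      then have "e \<in> S" by (simp add: sorted_ordered_list(2)[OF assms(1)])
      then show "((\<lambda>(u, z, m). (z, m < 0)) \<circ> grid_point q N) e = (\<lambda>(u, z, m). (z, m < q)) e"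
        using assms(2) grid_point_sign[of "snd (snd e)" q N "fst e" "fst (snd e)"]
        by (cases e) (auto simp: grid_point_def)
    qed
    finally show ?case .
  qed
qed

definition grid :: "real \<Rightarrow> nat \<Rightarrow> int \<Rightarrow> int \<Rightarrow> (real \<times> int \<times> real) set" where
  "grid T N a b = (of_int ` {0..\<lfloor>real N * T\<rfloor>}) \<times> {a..<b} \<times> (of_int ` {- int N - 1..int N})"

lemma finite_grid: "finite (grid T N a b)"
  by (simp add: grid_def)

lemma grid_point_image_subset: "grid_point q N ` block_points P T a b \<subseteq> grid T N a b"
proof (rule image_subsetI)
  fix e assume e: "e \<in> block_points P T a b"
  obtain u z m where [simp]: "e = (u, z, m)" by (metis prod_cases3)
  from e have *: "0 \<le> u" "u \<le> T" "0 \<le> m" "m \<le> 1" "a \<le> z" "z < b"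
    by (auto simp: block_points_def evs_def)
  then have "\<lfloor>real N * u\<rfloor> \<in> {0..\<lfloor>real N * T\<rfloor>}"
    using floor_le_of_le[of u T N] by auto
  moreover have "(if m < q then \<lfloor>real N * m\<rfloor> - int N - 1 else \<lfloor>real N * m\<rfloor>) \<in> {- int N - 1..int N}"
    using floor_unit_bounds[OF *(3,4), of N] by (auto simp del: zero_le_floor)
  ultimately show "grid_point q N e \<in> grid T N a b"
    using * unfolding grid_point_def grid_def by auto
qed

section \<open>Measurability derived from counts of rings\<close>

locale clocks =
  fixes M :: "'a measure" and T :: real and rate :: "int \<Rightarrow> real \<Rightarrow> real"
    and P :: "int \<Rightarrow> 'a \<Rightarrow> (real \<times> real) set" and k :: nat and U :: "nat \<Rightarrow> 'a \<Rightarrow> real"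
  assumes poisson: "poisson_family M T rate P k U"
begin

sublocale prob_space M
  by (rule conjunct1[OF poisson[unfolded poisson_family_def]])

lemma count_event:
  fixes Z :: "int set" and J :: nat and A :: "nat \<Rightarrow> (real \<times> real) set"
    and n :: "int \<Rightarrow> nat \<Rightarrow> nat" and B :: "nat \<Rightarrow> real set"
  assumes "finite Z" "\<And>j. j < J \<Longrightarrow> A j \<in> sets (lborel \<Otimes>\<^sub>M lborel)"
    "\<And>j. j < J \<Longrightarrow> A j \<subseteq> {0..T} \<times> {0..1}" "disjoint_family_on A {..<J}"
    "\<And>i. i < k \<Longrightarrow> B i \<in> sets borel"
  defines "E \<equiv> {\<omega> \<in> space M. (\<forall>z\<in>Z. \<forall>j<J. finite (P z \<omega> \<inter> A j) \<and> card (P z \<omega> \<inter> A j) = n z j) \<and>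
      (\<forall>i<k. U i \<omega> \<in> B i)}"
  shows "E \<in> sets M"
    and "measure M E = (\<Prod>z\<in>Z. \<Prod>j<J. poisson_prob (intensity rate z (A j)) (n z j))
           * (\<Prod>i<k. measure lborel (B i \<inter> {0..1}))"
proof -
  note all = poisson[unfolded poisson_family_def, THEN conjunct2]
  note inst = spec[OF spec[OF spec[OF spec[OF spec[OF all, of Z], of J], of A], of n], of B]
  have "finite Z \<and> (\<forall>j<J. A j \<in> sets (lborel \<Otimes>\<^sub>M lborel) \<and> A j \<subseteq> {0..T} \<times> {0..1})
        \<and> disjoint_family_on A {..<J} \<and> (\<forall>i<k. B i \<in> sets borel)"
    by (intro conjI allI impI assms(1-5))
  from mp[OF inst this]
  show "E \<in> sets M"
    and "measure M E = (\<Prod>z\<in>Z. \<Prod>j<J. poisson_prob (intensity rate z (A j)) (n z j))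
           * (\<Prod>i<k. measure lborel (B i \<inter> {0..1}))"
    unfolding E_def Let_def by (rule conjunct1, rule conjunct2)
qed

lemma measurable_coin [measurable]:
  assumes "i < k"
  shows "Measurable.pred M (\<lambda>\<omega>. U i \<omega> < x)"
proof -
  let ?E = "{\<omega> \<in> space M.
      (\<forall>z\<in>{}. \<forall>j<(0::nat). finite (P z \<omega> \<inter> {}) \<and> card (P z \<omega> \<inter> {}) = 0) \<and>
      (\<forall>j<k. U j \<omega> \<in> (if j = i then {..<x} else UNIV))}"
  have "?E \<in> sets M"
    by (rule count_event(1)[where Z = "{}" and J = 0 and A = "\<lambda>_. {}" and n = "\<lambda>_ _. 0"
        and B = "\<lambda>j. if j = i then {..<x} else UNIV"]) (simp_all add: disjoint_family_on_def)
  moreover have "?E = {\<omega> \<in> space M. U i \<omega> < x}"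
    using assms by auto
  ultimately show ?thesis by (simp only: pred_def)
qed

lemma measurable_count:
  assumes "A \<in> sets (lborel \<Otimes>\<^sub>M lborel)" "A \<subseteq> {0..T} \<times> {0..1}"
  shows "Measurable.pred M (\<lambda>\<omega>. finite (P z \<omega> \<inter> A) \<and> card (P z \<omega> \<inter> A) = n)"
proof -
  let ?E = "{\<omega> \<in> space M.
      (\<forall>z\<in>{z}. \<forall>j<(1::nat). finite (P z \<omega> \<inter> A) \<and> card (P z \<omega> \<inter> A) = n) \<and>
      (\<forall>j<k. U j \<omega> \<in> UNIV)}"
  have "?E \<in> sets M"
    by (rule count_event(1)[where Z = "{z}" and J = 1 and A = "\<lambda>_. A" and n = "\<lambda>_ _. n"
        and B = "\<lambda>_. UNIV"]) (use assms in \<open>auto simp: disjoint_family_on_def\<close>)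
  moreover have "?E = {\<omega> \<in> space M. finite (P z \<omega> \<inter> A) \<and> card (P z \<omega> \<inter> A) = n}"
    by auto
  ultimately show ?thesis by (simp only: pred_def)
qed

lemma measurable_finite:
  assumes "A \<in> sets (lborel \<Otimes>\<^sub>M lborel)" "A \<subseteq> {0..T} \<times> {0..1}"
  shows "Measurable.pred M (\<lambda>\<omega>. finite (P z \<omega> \<inter> A))"
proof -
  note measurable_count[OF assms, measurable]
  have "Measurable.pred M (\<lambda>\<omega>. \<exists>n. finite (P z \<omega> \<inter> A) \<and> card (P z \<omega> \<inter> A) = n)"
    by measurable
  then show ?thesis by simp
qed

lemma measurable_empty:
  assumes "A \<in> sets (lborel \<Otimes>\<^sub>M lborel)" "A \<subseteq> {0..T} \<times> {0..1}"
  shows "Measurable.pred M (\<lambda>\<omega>. P z \<omega> \<inter> A = {})"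
  using measurable_count[OF assms, of z 0] by (rule measurable_cong[THEN iffD1, rotated]) auto

lemma evs_eq: "evs (\<lambda>z. P z \<omega>) T z = P z \<omega> \<inter> ({0..T} \<times> {0..1})"
  by (auto simp: evs_def)

lemma measurable_evs [measurable]:
  "Measurable.pred M (\<lambda>\<omega>. finite (evs (\<lambda>z. P z \<omega>) T z))"
  "Measurable.pred M (\<lambda>\<omega>. evs (\<lambda>z. P z \<omega>) T z = {})"
  unfolding evs_eq by (auto intro!: measurable_finite measurable_empty)

lemma measurable_isolated [measurable]:
  "Measurable.pred M (\<lambda>\<omega>. isolated (\<lambda>z. P z \<omega>) T a b)"
  unfolding isolated_def by measurable

text \<open>The points discretised to a given grid point form a Borel set of times and marks, and
  whether it contains a ring is a count event. The grid is finite, so finitely many such events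
  determine the image.\<close>

lemma measurable_grid_image:
  "Measurable.pred M (\<lambda>\<omega>. grid_point q N ` block_points (\<lambda>z. P z \<omega>) T a b = H)"
proof -
  have [measurable]: "Measurable.pred M (\<lambda>\<omega>. g \<in> grid_point q N ` block_points (\<lambda>z. P z \<omega>) T a b)" for g
  proof -
    obtain i z j where g: "g = (i, z, j)" by (metis prod_cases3)
    define A where "A = {x \<in> space (lborel \<Otimes>\<^sub>M lborel). 0 \<le> fst x \<and> fst x \<le> T \<and> 0 \<le> snd x \<and> snd x \<le> 1 \<and>
        real_of_int \<lfloor>real N * fst x\<rfloor> = i \<and>
        (if snd x < q then real_of_int \<lfloor>real N * snd x\<rfloor> - real N - 1 else real_of_int \<lfloor>real N * snd x\<rfloor>) = j}"
    have "A \<in> sets (lborel \<Otimes>\<^sub>M lborel)" unfolding A_def by measurable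
    moreover have "A \<subseteq> {0..T} \<times> {0..1}" by (auto simp: A_def)
    ultimately have [measurable]: "Measurable.pred M (\<lambda>\<omega>. P z \<omega> \<inter> A = {})" by (rule measurable_empty)
    have "g \<in> grid_point q N ` block_points (\<lambda>z. P z \<omega>) T a b \<longleftrightarrow> a \<le> z \<and> z < b \<and> P z \<omega> \<inter> A \<noteq> {}" for \<omega>
      unfolding g by (auto simp: A_def block_points_def evs_def grid_point_def space_pair_measure image_iff
        split: if_splits prod.splits) force+
    then show ?thesis by simp
  qed
  have "Measurable.pred M (\<lambda>\<omega>. H \<subseteq> grid T N a b \<and>
      (\<forall>g\<in>grid T N a b. g \<in> grid_point q N ` block_points (\<lambda>z. P z \<omega>) T a b \<longleftrightarrow> g \<in> H))"
    using finite_grid by measurable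
  also have "(\<lambda>\<omega>. H \<subseteq> grid T N a b \<and> (\<forall>g\<in>grid T N a b. g \<in> grid_point q N ` block_points (\<lambda>z. P z \<omega>) T a b \<longleftrightarrow> g \<in> H)) =
      (\<lambda>\<omega>. grid_point q N ` block_points (\<lambda>z. P z \<omega>) T a b = H)"
    using grid_point_image_subset by (intro ext) blast
  finally show ?thesis .
qed

lemma measurable_grid_word:
  "Measurable.pred M (\<lambda>\<omega>. point_word 0 (grid_point q N ` block_points (\<lambda>z. P z \<omega>) T a b) = w)"
proof -
  define X where "X = {H. H \<subseteq> grid T N a b \<and> point_word 0 H = w}"
  have "finite X"
    by (rule finite_subset[of _ "Pow (grid T N a b)"]) (auto simp: X_def finite_grid)
  then have "Measurable.pred M (\<lambda>\<omega>. \<exists>H\<in>X. grid_point q N ` block_points (\<lambda>z. P z \<omega>) T a b = H)"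
    by (rule pred_intros_finite(4)) (rule measurable_grid_image)
  also have "(\<lambda>\<omega>. \<exists>H\<in>X. grid_point q N ` block_points (\<lambda>z. P z \<omega>) T a b = H) =
      (\<lambda>\<omega>. point_word 0 (grid_point q N ` block_points (\<lambda>z. P z \<omega>) T a b) = w)"
    using grid_point_image_subset by (auto simp: X_def)
  finally show ?thesis .
qed

text \<open>The word is the eventual value of the words of the discretisations, hence obtained by
  countable operations. Isolation stays in the event because it provides the finiteness on which
  this limit rests.\<close>

lemma measurable_block_word:
  "Measurable.pred M (\<lambda>\<omega>. isolated (\<lambda>z. P z \<omega>) T a b \<and> block_word q (\<lambda>z. P z \<omega>) T a b = w)"
proof -
  have eq: "block_word q (\<lambda>z. P z \<omega>) T a b = w \<longleftrightarrow>
      (\<exists>N0. \<forall>N\<in>{N0..}. point_word 0 (grid_point q N ` block_points (\<lambda>z. P z \<omega>) T a b) = w)"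
    if iso: "isolated (\<lambda>z. P z \<omega>) T a b" for \<omega>
  proof -
    let ?S = "block_points (\<lambda>z. P z \<omega>) T a b"
    have fin: "finite ?S" using iso by (rule isolated_finite)
    have "\<forall>\<^sub>F N in sequentially. point_word 0 (grid_point q N ` ?S) = point_word q ?S"
      by (rule eventually_point_word_grid[OF fin]) (auto simp: block_points_def evs_def)
    then obtain N1 where N1: "\<And>N. N1 \<le> N \<Longrightarrow> point_word 0 (grid_point q N ` ?S) = point_word q ?S"
      unfolding eventually_sequentially by blast
    show ?thesis
      unfolding block_word_eq_point_word[OF fin]
    proof
      assume "point_word q ?S = w"
      then show "\<exists>N0. \<forall>N\<in>{N0..}. point_word 0 (grid_point q N ` ?S) = w" using N1 by auto
    next
      assume "\<exists>N0. \<forall>N\<in>{N0..}. point_word 0 (grid_point q N ` ?S) = w"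
      then obtain N0 where "\<And>N. N0 \<le> N \<Longrightarrow> point_word 0 (grid_point q N ` ?S) = w" by auto
      from this[of "max N0 N1"] N1[of "max N0 N1"] show "point_word q ?S = w" by simp
    qed
  qed
  have "Measurable.pred M (\<lambda>\<omega>. isolated (\<lambda>z. P z \<omega>) T a b \<and>
      (\<exists>N0. \<forall>N\<in>{N0..}. point_word 0 (grid_point q N ` block_points (\<lambda>z. P z \<omega>) T a b) = w))"
    by (rule pred_intros_logic(3)[OF measurable_isolated pred_intros_countable(2)],
        rule pred_intros_countable_bounded(3), rule measurable_grid_word)
  also have "(\<lambda>\<omega>. isolated (\<lambda>z. P z \<omega>) T a b \<and>
      (\<exists>N0. \<forall>N\<in>{N0..}. point_word 0 (grid_point q N ` block_points (\<lambda>z. P z \<omega>) T a b) = w)) =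
      (\<lambda>\<omega>. isolated (\<lambda>z. P z \<omega>) T a b \<and> block_word q (\<lambda>z. P z \<omega>) T a b = w)"
    using eq by (intro ext conj_cong refl) simp
  finally show ?thesis .
qed

text \<open>By \<open>asep_isolated\<close> any block around x gives the right color, so the
  unspecified choice can be replaced by a countable union over all blocks and words; sites without a
  block form the remaining case.\<close>

lemma measurable_asep_at:
  "Measurable.pred M (\<lambda>\<omega>. asep q (\<lambda>z. P z \<omega>) T \<xi> x = y)"
proof -
  define X where "X = {(a, b, w). x \<in> {a..b} \<and> run_word w \<xi> x = y}"
  define Y where "Y = {(a, b). x \<in> {a..b}}"
  define hit where "hit = (\<lambda>\<omega>. \<exists>c\<in>X. isolated (\<lambda>z. P z \<omega>) T (fst c) (fst (snd c)) \<and>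
      block_word q (\<lambda>z. P z \<omega>) T (fst c) (fst (snd c)) = snd (snd c))"
  define covered where "covered = (\<lambda>\<omega>. \<exists>c\<in>Y. isolated (\<lambda>z. P z \<omega>) T (fst c) (snd c))"
  have hit: "Measurable.pred M hit"
    unfolding hit_def by (rule pred_intros_countable_bounded(4)) (rule measurable_block_word)
  have covered: "Measurable.pred M covered"
    unfolding covered_def by (rule pred_intros_countable_bounded(4)) (rule measurable_isolated)
  have eq: "asep q (\<lambda>z. P z \<omega>) T \<xi> x = y \<longleftrightarrow> hit \<omega> \<or> \<not> covered \<omega> \<and> \<xi> x = y" for \<omega>
  proof (cases "\<exists>a b. isolated (\<lambda>z. P z \<omega>) T a b \<and> x \<in> {a..b}")
    case True
    then obtain a b where ab: "isolated (\<lambda>z. P z \<omega>) T a b" "x \<in> {a..b}" by blast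
    have "covered \<omega>" using ab by (auto simp: covered_def Y_def)
    moreover have "hit \<omega> \<longleftrightarrow> asep q (\<lambda>z. P z \<omega>) T \<xi> x = y"
    proof
      assume "hit \<omega>"
      then obtain a' b' where "isolated (\<lambda>z. P z \<omega>) T a' b'" "x \<in> {a'..b'}"
        "run_word (block_word q (\<lambda>z. P z \<omega>) T a' b') \<xi> x = y"
        by (auto simp: hit_def X_def)
      then show "asep q (\<lambda>z. P z \<omega>) T \<xi> x = y" using asep_isolated by simp
    next
      assume "asep q (\<lambda>z. P z \<omega>) T \<xi> x = y"
      then have "run_word (block_word q (\<lambda>z. P z \<omega>) T a b) \<xi> x = y"
        using asep_isolated[OF ab] by simp
      then have "(a, b, block_word q (\<lambda>z. P z \<omega>) T a b) \<in> X" using ab by (simp add: X_def)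
      then show "hit \<omega>" unfolding hit_def by (rule bexI[rotated]) (simp add: ab)
    qed
    ultimately show ?thesis by blast
  next
    case False
    then have "\<not> hit \<omega>" "\<not> covered \<omega>" by (auto simp: hit_def covered_def X_def Y_def)
    then show ?thesis using asep_not_isolated[OF False, of q \<xi>] by simp
  qed
  show ?thesis
  proof (cases "\<xi> x = y")
    case True
    then show ?thesis
      unfolding eq by simp (intro pred_intros_logic(2,5) hit covered)
  next
    case False
    then show ?thesis unfolding eq using hit by simp
  qed
qed

lemma measurable_coins:
  "Measurable.pred M (\<lambda>\<omega>. map (\<lambda>i. U i \<omega> < q) [0..<k] = c)"
proof -
  have "Measurable.pred M (\<lambda>\<omega>. length c = k \<and> (\<forall>i\<in>{..<k}. (U i \<omega> < q) = c ! i))"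
    by (intro pred_intros_logic pred_intros_finite) (auto intro!: pred_intros_logic measurable_coin)
  also have "(\<lambda>\<omega>. length c = k \<and> (\<forall>i\<in>{..<k}. (U i \<omega> < q) = c ! i)) =
      (\<lambda>\<omega>. map (\<lambda>i. U i \<omega> < q) [0..<k] = c)"
    by (auto simp: list_eq_iff_nth_eq)
  finally show ?thesis .
qed

lemma measurable_into_config_space:
  assumes "\<And>x y. Measurable.pred M (\<lambda>\<omega>. X \<omega> x = y)"
  shows "X \<in> M \<rightarrow>\<^sub>M config_space"
proof -
  have "(\<lambda>\<omega>. X \<omega> x) \<in> M \<rightarrow>\<^sub>M count_space UNIV" for x
    using assms by (subst measurable_count_space_eq_countable)
      (auto simp: pred_def vimage_def Int_def conj_commute)
  then show ?thesis
    unfolding config_space_def by (intro measurable_PiM_single') (auto simp: space_PiM)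
qed

end

section \<open>Discretised clocks as random words\<close>

text \<open>The letter \<^term>\<open>Some (z, b)\<close> stands for a ring of the clock at \<open>(z, z + 1)\<close> whose mark is below \<open>q\<close>
iff \<open>b\<close>, and \<^term>\<open>None\<close> for the absence of a ring.\<close>
definition letters :: "int set \<Rightarrow> (int \<times> bool) option set" where
  "letters Z = insert None (Some ` (Z \<times> UNIV))"

definition words :: "int set \<Rightarrow> nat \<Rightarrow> (int \<times> bool) option list set" where
  "words Z n = {x. set x \<subseteq> letters Z \<and> length x = n}"

definition decode :: "(int \<times> bool) option list \<Rightarrow> (int \<times> bool) list" where
  "decode x = map the (filter (\<lambda>l. l \<noteq> None) x)"

lemma decode_simps [simp]:
  "decode [] = []" "decode (None # x) = decode x" "decode (Some e # x) = e # decode x"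
  by (simp_all add: decode_def)

definition coin_weight :: "real \<Rightarrow> bool \<Rightarrow> real" where
  "coin_weight q b = (if b then q else 1 - q)"

definition letter_weight :: "real \<Rightarrow> (int option \<Rightarrow> real) \<Rightarrow> (int \<times> bool) option \<Rightarrow> real" where
  "letter_weight q a l = (case l of None \<Rightarrow> a None | Some (z, b) \<Rightarrow> a (Some z) * coin_weight q b)"

text \<open>A prescribed swap as a degenerate letter. Swaps and time cells become factors of the
  same kind, and the reversal lemma applies to their concatenation.\<close>

definition swap_letter :: "int \<Rightarrow> int option \<Rightarrow> real" where
  "swap_letter s l = (if l = Some s then 1 else 0)"

lemma words_nth: "x \<in> words Z n \<Longrightarrow> i < n \<Longrightarrow> x ! i \<in> letters Z"
  by (auto simp: words_def)

lemma finite_letters: "finite Z \<Longrightarrow> finite (letters Z)"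
  by (simp add: letters_def)

lemma finite_words: "finite Z \<Longrightarrow> finite (words Z n)"
  by (simp add: words_def finite_letters finite_lists_length_eq)

lemma finite_coins: "finite {c :: bool list. length c = n}"
  using finite_lists_length_eq[of "UNIV :: bool set" n] by simp

lemma sum_letters:
  assumes "finite Z"
  shows "(\<Sum>l\<in>letters Z. g l) = g None + (\<Sum>z\<in>Z. g (Some (z, True)) + g (Some (z, False)))"
proof -
  have "(\<Sum>l\<in>letters Z. g l) = g None + (\<Sum>l\<in>Some ` (Z \<times> UNIV). g l)"
    unfolding letters_def using assms by (subst sum.insert) auto
  also have "(\<Sum>l\<in>Some ` (Z \<times> UNIV). g l) = (\<Sum>e\<in>Z \<times> UNIV. g (Some e))"
    by (subst sum.reindex) (auto simp: inj_on_def)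
  also have "\<dots> = (\<Sum>z\<in>Z. \<Sum>b\<in>UNIV. g (Some (z, b)))"
    by (simp add: sum.cartesian_product)
  finally show ?thesis by (simp add: UNIV_bool add.commute)
qed

lemma sum_lists_Suc:
  fixes g :: "'b list \<Rightarrow> real"
  shows "(\<Sum>x | set x \<subseteq> A \<and> length x = Suc n. g x) =
    (\<Sum>a\<in>A. \<Sum>x | set x \<subseteq> A \<and> length x = n. g (a # x))"
proof -
  have "(\<Sum>x | set x \<subseteq> A \<and> length x = Suc n. g x) =
      (\<Sum>(x, a)\<in>{x. set x \<subseteq> A \<and> length x = n} \<times> A. g (a # x))"
    unfolding lists_length_Suc_eq by (subst sum.reindex) (auto simp: inj_on_def case_prod_beta)
  then show ?thesis by (simp add: sum.cartesian_product[symmetric] sum.swap[of _ A])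
qed

text \<open>The expectation of f after independent random letters, with weights that need not be
  normalised. Splitting off the first letter produces the outermost operator.\<close>

lemma sum_words:
  assumes "finite Z"
  shows "(\<Sum>x\<in>words Z (length as). prod_list (map2 (letter_weight q) as x) * f (run_word (decode x) \<eta>)) =
    foldr (opR q Z) as f \<eta>"
proof (induction as arbitrary: \<eta>)
  case Nil
  have "words Z 0 = {[]}" by (auto simp: words_def)
  then show ?case by (simp add: decode_def)
next
  case (Cons a as)
  define S where "S \<xi> =
    (\<Sum>x\<in>words Z (length as). prod_list (map2 (letter_weight q) as x) * f (run_word (decode x) \<xi>))" for \<xi>
  define step where "step l = (case l of None \<Rightarrow> \<eta> | Some (z, b) \<Rightarrow> bswap z b \<eta>)" for l
  have "run_word (decode (l # x)) \<eta> = run_word (decode x) (step l)" for l x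
    by (auto simp: step_def split: option.split)
  then have "(\<Sum>x\<in>words Z (length (a # as)).
      prod_list (map2 (letter_weight q) (a # as) x) * f (run_word (decode x) \<eta>)) =
      (\<Sum>l\<in>letters Z. letter_weight q a l * S (step l))"
    unfolding words_def list.size add_Suc_right add_0_right S_def
    by (subst sum_lists_Suc) (simp add: sum_distrib_left mult.assoc)
  also have "\<dots> = opR q Z a S \<eta>"
    unfolding sum_letters[OF assms]
    by (simp add: letter_weight_def coin_weight_def opR_def swapR_def step_def distrib_left mult.assoc)
  also have "S = foldr (opR q Z) as f" using Cons.IH by (auto simp: S_def)
  finally show ?case by simp
qed

lemma opR_swap_letter:
  assumes "finite Z" "s \<in> Z"
  shows "opR q Z (swap_letter s) f = swapR q s f"
proof
  fix \<eta>
  have "(\<Sum>z\<in>Z. swap_letter s (Some z) * swapR q z f \<eta>) = (\<Sum>z\<in>Z. if z = s then swapR q z f \<eta> else 0)"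
    by (intro sum.cong) (auto simp: swap_letter_def)
  then show "opR q Z (swap_letter s) f \<eta> = swapR q s f \<eta>"
    using assms by (simp add: opR_def) (simp add: swap_letter_def)
qed

lemma sum_coins:
  assumes "finite Z" "set ss \<subseteq> Z"
  shows "(\<Sum>c | length c = length ss. prod_list (map (coin_weight q) c) * f (run_word (zip ss c) \<eta>)) =
    foldr (opR q Z) (map swap_letter ss) f \<eta>"
  using assms(2)
proof (induction ss arbitrary: \<eta>)
  case (Cons s ss)
  define S where "S \<xi> =
    (\<Sum>c | length c = length ss. prod_list (map (coin_weight q) c) * f (run_word (zip ss c) \<xi>))" for \<xi>
  have "(\<Sum>c | length c = length (s # ss).
      prod_list (map (coin_weight q) c) * f (run_word (zip (s # ss) c) \<eta>)) =
      (\<Sum>b\<in>UNIV. coin_weight q b * S (bswap s b \<eta>))"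
    using sum_lists_Suc[where A = "UNIV :: bool set" and n = "length ss" and
        g = "\<lambda>c. prod_list (map (coin_weight q) c) * f (run_word (zip (s # ss) c) \<eta>)"]
    by (simp add: sum_distrib_left mult.assoc S_def)
  also have "\<dots> = swapR q s S \<eta>"
    by (simp add: UNIV_bool coin_weight_def swapR_def)
  also have "\<dots> = opR q Z (swap_letter s) S \<eta>"
    using Cons.prems assms(1) by (simp add: opR_swap_letter)
  also have "S = foldr (opR q Z) (map swap_letter ss) f" using Cons by (auto simp: S_def)
  finally show ?case by simp
qed simp

lemma opR_const: "opR q Z a (\<lambda>_. c) = (\<lambda>_. (a None + (\<Sum>z\<in>Z. a (Some z))) * c)"
proof -
  have "swapR q z (\<lambda>_. c) \<eta> = c" for z \<eta> by (simp add: swapR_def algebra_simps)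
  then show ?thesis by (auto simp: opR_def distrib_right sum_distrib_right)
qed

lemma foldr_opR_one:
  "foldr (opR q Z) as (\<lambda>_. 1) = (\<lambda>_. \<Prod>a\<leftarrow>as. a None + (\<Sum>z\<in>Z. a (Some z)))"
  by (induction as) (simp_all add: opR_const)

text \<open>\<open>poisson_family\<close> numbers its disjoint sets by one index. The pair of a cell
  i and a mark class b is encoded as 2 * i or 2 * i + 1, with b the parity test.\<close>

lemma all_less_double:
  "(\<forall>j<2 * n. Q (j div 2) (even j)) \<longleftrightarrow> (\<forall>i<n. \<forall>b. Q i b)" for n :: nat
proof safe
  fix i b assume *: "\<forall>j<2 * n. Q (j div 2) (even j)" "i < n"
  show "Q i b"
  proof (cases b)
    case True
    then show ?thesis using *(1)[rule_format, of "2 * i"] *(2) by simp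
  next
    case False
    then show ?thesis using *(1)[rule_format, of "2 * i + 1"] *(2) by simp
  qed
qed (simp add: less_mult_imp_div_less mult.commute)

lemma prod_less_double:
  "(\<Prod>j<2 * n. h (j div 2) (even j)) = (\<Prod>i<n. h i True * h i False :: real)" for n :: nat
  by (induction n) (simp_all add: mult.assoc)

lemma prod_list_eq_prod_nth: "prod_list xs = (\<Prod>i<length xs. xs ! i)"
  by (simp add: prod.list_conv_set_nth atLeast0LessThan)

section \<open>The law of the word read off from time cells\<close>

locale bounded_clocks = clocks M T rate P k U + rate_bound T C rate
  for M :: "'a measure" and T C :: real and rate P k U

text \<open>The cells are kept abstract because the reversed process uses reflected cells, which are
  closed at the other end.\<close>

locale cells = bounded_clocks M T C rate P k U
  for M :: "'a measure" and T C :: real and rate P k U +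
  fixes q :: real and lo hi :: int and B :: "nat \<Rightarrow> real set" and n :: nat
  assumes q: "0 \<le> q" "q \<le> 1"
    and B_borel: "i < n \<Longrightarrow> B i \<in> sets borel"
    and B_sub: "i < n \<Longrightarrow> B i \<subseteq> {0..T}"
    and B_cover: "{0..T} \<subseteq> (\<Union>i<n. B i)"
    and B_less: "i < j \<Longrightarrow> j < n \<Longrightarrow> u \<in> B i \<Longrightarrow> v \<in> B j \<Longrightarrow> u < v"
begin

abbreviation Z :: "int set" where "Z \<equiv> {lo..<hi}"

definition marks :: "bool \<Rightarrow> real set" where
  "marks b = (if b then {0..<q} else {q..1})"

text \<open>The counts are prescribed for all edges and both mark classes, so in each cell the
  window contains no ring besides the one named by the letter.\<close>

definition cell_event :: "(int \<times> bool) option list \<Rightarrow> bool list \<Rightarrow> 'a set" where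
  "cell_event x c = {\<omega> \<in> space M.
     (\<forall>z\<in>Z. \<forall>i<n. \<forall>b. finite (P z \<omega> \<inter> (B i \<times> marks b)) \<and>
        card (P z \<omega> \<inter> (B i \<times> marks b)) = of_bool (x ! i = Some (z, b))) \<and>
     (\<forall>i<k. (U i \<omega> < q) = c ! i)}"

text \<open>Independent Poisson counts: the probability of no ring in the window during the cell,
  and of a single ring, at z. Several rings are left out, so the total is at most one.\<close>

definition cell_letter :: "nat \<Rightarrow> int option \<Rightarrow> real" where
  "cell_letter i l = (\<Prod>z\<in>Z. exp (- mass rate z (B i))) *
     (case l of None \<Rightarrow> 1 | Some z \<Rightarrow> mass rate z (B i))"

lemma intensity_marks:
  assumes "i < n"
  shows "intensity rate z (B i \<times> marks b) = mass rate z (B i) * coin_weight q b"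
  using intensity_Times[OF B_borel[OF assms] B_sub[OF assms], of "marks b" z] q
  by (auto simp: marks_def coin_weight_def)

lemma poisson_prob_of_bool: "poisson_prob a (of_bool Q) = exp (- a) * (if Q then a else 1)"
  by (simp add: poisson_prob_def)

text \<open>Poisson thinning: the mark classes have intensities m q and m (1 - q), whose
  exponentials multiply to exp (- m), and a single ring contributes its own intensity as a
  factor.\<close>

lemma cell_weight:
  assumes "l \<in> letters Z"
  shows "(\<Prod>z\<in>Z. poisson_prob (mass rate z (B i) * coin_weight q True) (of_bool (l = Some (z, True))) *
      poisson_prob (mass rate z (B i) * coin_weight q False) (of_bool (l = Some (z, False)))) =
    letter_weight q (cell_letter i) l"
proof -
  have exp: "exp (- (m * coin_weight q True)) * exp (- (m * coin_weight q False)) = exp (- m)" for m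
    by (simp only: mult_exp_exp) (simp add: coin_weight_def algebra_simps)
  have factor: "poisson_prob (m * coin_weight q True) (of_bool X) *
      poisson_prob (m * coin_weight q False) (of_bool Y) =
      exp (- m) * ((if X then m * coin_weight q True else 1) * (if Y then m * coin_weight q False else 1))"
    for m X Y
  proof -
    have "a * x * (b * y) = (a * b) * (x * y)" for a b x y :: real by simp
    then show ?thesis by (simp only: poisson_prob_of_bool exp)
  qed
  show ?thesis
  proof (cases l)
    case None
    then show ?thesis
      unfolding factor by (simp add: letter_weight_def cell_letter_def)
  next
    case (Some e)
    then obtain z b where l: "l = Some (z, b)" "z \<in> Z" using assms by (auto simp: letters_def)
    have "(\<Prod>y\<in>Z. (if l = Some (y, True) then mass rate y (B i) * coin_weight q True else 1) *
        (if l = Some (y, False) then mass rate y (B i) * coin_weight q False else 1)) =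
        (\<Prod>y\<in>Z. if y = z then mass rate z (B i) * coin_weight q b else 1)"
      using l by (intro prod.cong) auto
    also have "\<dots> = mass rate z (B i) * coin_weight q b"
      using l(2) by (subst prod.delta) auto
    finally show ?thesis
      unfolding factor prod.distrib[of "\<lambda>z. exp (- mass rate z (B i))"]
      by (simp add: l letter_weight_def cell_letter_def)
  qed
qed

lemma cell_event:
  assumes x: "x \<in> words Z n" and c: "length c = k"
  shows "cell_event x c \<in> sets M"
    and "measure M (cell_event x c) =
      prod_list (map2 (letter_weight q) (map cell_letter [0..<n]) x) * prod_list (map (coin_weight q) c)"
proof -
  define A where "A j = B (j div 2) \<times> marks (even j)" for j :: nat
  define m :: "int \<Rightarrow> nat \<Rightarrow> nat" where "m z j = of_bool (x ! (j div 2) = Some (z, even j))" for z j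
  define D where "D i = (if c ! i then {..<q} else {q..})" for i
  let ?E = "{\<omega> \<in> space M. (\<forall>z\<in>Z. \<forall>j<2 * n. finite (P z \<omega> \<inter> A j) \<and> card (P z \<omega> \<inter> A j) = m z j) \<and>
      (\<forall>i<k. U i \<omega> \<in> D i)}"
  have E: "cell_event x c = ?E"
    unfolding cell_event_def A_def m_def
      all_less_double[of n "\<lambda>i b. finite (P z \<omega> \<inter> (B i \<times> marks b)) \<and>
        card (P z \<omega> \<inter> (B i \<times> marks b)) = of_bool (x ! i = Some (z, b))" for z \<omega>]
    by (auto simp: D_def not_less split: if_splits)
  have half: "j div 2 < n" if "j < 2 * n" for j using that by auto
  have A_sets: "A j \<in> sets (lborel \<Otimes>\<^sub>M lborel)" if "j < 2 * n" for j
    using B_borel[OF half[OF that]] unfolding A_def marks_def by (intro pair_measureI) auto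
  have A_sub: "A j \<subseteq> {0..T} \<times> {0..1}" if "j < 2 * n" for j
    using B_sub[OF half[OF that]] q unfolding A_def marks_def by auto
  have A_disj: "disjoint_family_on A {..<2 * n}"
    unfolding disjoint_family_on_def
  proof (intro ballI impI)
    fix i j assume ij: "i \<in> {..<2 * n}" "j \<in> {..<2 * n}" "i \<noteq> j"
    show "A i \<inter> A j = {}"
    proof (cases "i div 2 = j div 2")
      case True
      then have "even i \<noteq> even j" using ij(3) by (metis div_mult_mod_eq parity_cases)
      then show ?thesis by (auto simp: A_def marks_def)
    next
      case False
      then have "i div 2 < j div 2 \<or> j div 2 < i div 2" by linarith
      then have "B (i div 2) \<inter> B (j div 2) = {}" using B_less half ij by fastforce
      then show ?thesis by (auto simp: A_def)
    qed
  qed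
  have D_sets: "D i \<in> sets borel" for i by (simp add: D_def)
  note count = count_event[where Z = Z and J = "2 * n" and A = A and n = m and B = D,
      OF _ A_sets A_sub A_disj D_sets]
  show "cell_event x c \<in> sets M" unfolding E by (rule count(1)) auto
  have "measure M (cell_event x c) =
      (\<Prod>z\<in>Z. \<Prod>j<2 * n. poisson_prob (intensity rate z (A j)) (m z j)) *
      (\<Prod>i<k. measure lborel (D i \<inter> {0..1}))"
    unfolding E by (rule count(2)) auto
  also have "(\<Prod>i<k. measure lborel (D i \<inter> {0..1})) = (\<Prod>i<k. coin_weight q (c ! i))"
  proof (rule prod.cong[OF refl])
    fix i
    have "{..<q} \<inter> {0..1} = {0..<q}" "{q..} \<inter> {0..1} = {q..1}" using q by auto
    then show "measure lborel (D i \<inter> {0..1}) = coin_weight q (c ! i)"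
      using q by (simp add: D_def coin_weight_def)
  qed
  also have "\<dots> = prod_list (map (coin_weight q) c)"
    by (simp add: prod_list_eq_prod_nth c)
  also have "(\<Prod>z\<in>Z. \<Prod>j<2 * n. poisson_prob (intensity rate z (A j)) (m z j)) =
      (\<Prod>z\<in>Z. \<Prod>i<n. poisson_prob (intensity rate z (B i \<times> marks True)) (of_bool (x ! i = Some (z, True))) *
        poisson_prob (intensity rate z (B i \<times> marks False)) (of_bool (x ! i = Some (z, False))))"
    unfolding A_def m_def
    by (intro prod.cong refl prod_less_double[of "\<lambda>i b. poisson_prob (intensity rate z (B i \<times> marks b))
        (of_bool (x ! i = Some (z, b)))" for z])
  also have "\<dots> = (\<Prod>i<n. letter_weight q (cell_letter i) (x ! i))"
  proof (subst prod.swap, rule prod.cong[OF refl])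
    fix i assume "i \<in> {..<n}"
    then have i: "i < n" by simp
    then have "x ! i \<in> letters Z" by (rule words_nth[OF x])
    from cell_weight[OF this, of i] show "(\<Prod>z\<in>Z.
        poisson_prob (intensity rate z (B i \<times> marks True)) (of_bool (x ! i = Some (z, True))) *
        poisson_prob (intensity rate z (B i \<times> marks False)) (of_bool (x ! i = Some (z, False)))) =
        letter_weight q (cell_letter i) (x ! i)"
      unfolding intensity_marks[OF i] .
  qed
  also have "\<dots> = prod_list (map2 (letter_weight q) (map cell_letter [0..<n]) x)"
    using x by (simp add: prod_list_eq_prod_nth words_def)
  finally show "measure M (cell_event x c) =
      prod_list (map2 (letter_weight q) (map cell_letter [0..<n]) x) * prod_list (map (coin_weight q) c)" .
qed

end

section \<open>Silent edges on both sides of a window\<close>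

context bounded_clocks
begin

definition empty_prob :: "int \<Rightarrow> real" where
  "empty_prob z = exp (- intensity rate z ({0..T} \<times> {0..1}))"

text \<open>Bounded rates make an edge silent with a probability bounded below uniformly in z, which
  later yields a geometric bound.\<close>

lemma empty_prob_bounds: "exp (- C * T) \<le> empty_prob z" "empty_prob z \<le> 1"
proof -
  have eq: "intensity rate z ({0..T} \<times> {0..1}) = mass rate z {0..T}"
    using intensity_Times[of "{0..T}" "{0..1}" z] by simp
  have "mass rate z {0..T} \<le> C * T" using mass_le[of "{0..T}" z] T by simp
  then show "exp (- C * T) \<le> empty_prob z" by (simp add: empty_prob_def eq)
  show "empty_prob z \<le> 1" by (simp add: empty_prob_def eq mass_nonneg)
qed

lemma prob_empty:
  assumes "finite Z"
  shows "measure M {\<omega> \<in> space M. \<forall>z\<in>Z. evs (\<lambda>z. P z \<omega>) T z = {}} = (\<Prod>z\<in>Z. empty_prob z)"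
proof -
  let ?A = "{0..T} \<times> {0..1::real}"
  let ?E = "{\<omega> \<in> space M.
      (\<forall>z\<in>Z. \<forall>j<(1::nat). finite (P z \<omega> \<inter> ?A) \<and> card (P z \<omega> \<inter> ?A) = 0) \<and> (\<forall>j<k. U j \<omega> \<in> UNIV)}"
  have "measure M ?E = (\<Prod>z\<in>Z. \<Prod>j<(1::nat). poisson_prob (intensity rate z ?A) 0)
      * (\<Prod>i<k. measure lborel (UNIV \<inter> {0..1::real}))"
    by (rule count_event(2)[where Z = Z and J = 1 and A = "\<lambda>_. ?A" and n = "\<lambda>_ _. 0"
        and B = "\<lambda>_. UNIV"]) (use assms in \<open>auto simp: disjoint_family_on_def\<close>)
  also have "\<dots> = (\<Prod>z\<in>Z. empty_prob z)"
    by (simp add: poisson_prob_def empty_prob_def)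
  also have "?E = {\<omega> \<in> space M. \<forall>z\<in>Z. evs (\<lambda>z. P z \<omega>) T z = {}}"
  proof -
    have "finite X \<and> card X = 0 \<longleftrightarrow> X = {}" for X :: "(real \<times> real) set" by auto
    then show ?thesis unfolding evs_eq by simp
  qed
  finally show ?thesis .
qed

lemma sets_empty_nonempty:
  assumes "finite Z1" "finite Z2"
  shows "{\<omega> \<in> space M. (\<forall>z\<in>Z1. evs (\<lambda>z. P z \<omega>) T z = {}) \<and> (\<forall>z\<in>Z2. evs (\<lambda>z. P z \<omega>) T z \<noteq> {})} \<in> sets M"
proof -
  have "Measurable.pred M (\<lambda>\<omega>. (\<forall>z\<in>Z1. evs (\<lambda>z. P z \<omega>) T z = {}) \<and> (\<forall>z\<in>Z2. evs (\<lambda>z. P z \<omega>) T z \<noteq> {}))"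
    using measurable_evs(2)
    by (intro pred_intros_logic(3) pred_intros_finite(3) assms pred_intros_logic(2)) auto
  then show ?thesis by (simp only: pred_def)
qed

text \<open>Inclusion--exclusion, one site of \<open>Z2\<close> at a time.\<close>
lemma prob_empty_nonempty:
  assumes "finite Z1" "finite Z2" "Z1 \<inter> Z2 = {}"
  shows "measure M {\<omega> \<in> space M. (\<forall>z\<in>Z1. evs (\<lambda>z. P z \<omega>) T z = {}) \<and> (\<forall>z\<in>Z2. evs (\<lambda>z. P z \<omega>) T z \<noteq> {})} =
    (\<Prod>z\<in>Z1. empty_prob z) * (\<Prod>z\<in>Z2. 1 - empty_prob z)"
  using assms(2,1,3)
proof (induction Z2 arbitrary: Z1 rule: finite_induct)
  case empty
  then show ?case using prob_empty[OF empty(1)] by simp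
next
  case (insert y Z2)
  define E where "E X Y = {\<omega> \<in> space M. (\<forall>z\<in>X. evs (\<lambda>z. P z \<omega>) T z = {}) \<and>
    (\<forall>z\<in>Y. evs (\<lambda>z. P z \<omega>) T z \<noteq> {})}" for X Y
  have sub: "E (insert y Z1) Z2 \<subseteq> E Z1 Z2" by (auto simp: E_def)
  have diff: "E Z1 (insert y Z2) = E Z1 Z2 - E (insert y Z1) Z2" by (auto simp: E_def)
  have sets: "E Z1 Z2 \<in> sets M" "E (insert y Z1) Z2 \<in> sets M"
    unfolding E_def using insert by (auto intro!: sets_empty_nonempty)
  have "measure M (E Z1 (insert y Z2)) = measure M (E Z1 Z2) - measure M (E (insert y Z1) Z2)"
    unfolding diff by (rule finite_measure_Diff[OF sets sub])
  also have "measure M (E Z1 Z2) = (\<Prod>z\<in>Z1. empty_prob z) * (\<Prod>z\<in>Z2. 1 - empty_prob z)"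
    unfolding E_def using insert.prems by (intro insert.IH) auto
  also have "measure M (E (insert y Z1) Z2) =
      (\<Prod>z\<in>insert y Z1. empty_prob z) * (\<Prod>z\<in>Z2. 1 - empty_prob z)"
    unfolding E_def using insert.prems insert.hyps by (intro insert.IH) auto
  also have "(\<Prod>z\<in>insert y Z1. empty_prob z) = empty_prob y * (\<Prod>z\<in>Z1. empty_prob z)"
    using insert.prems by (subst prod.insert) auto
  finally show ?case
    using insert.hyps unfolding E_def by (simp add: algebra_simps)
qed

lemma prob_nonempty_le:
  assumes "finite Z"
  shows "measure M {\<omega> \<in> space M. \<forall>z\<in>Z. evs (\<lambda>z. P z \<omega>) T z \<noteq> {}} \<le> (1 - exp (- C * T)) ^ card Z"
proof -
  have "measure M {\<omega> \<in> space M. \<forall>z\<in>Z. evs (\<lambda>z. P z \<omega>) T z \<noteq> {}} = (\<Prod>z\<in>Z. 1 - empty_prob z)"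
    using prob_empty_nonempty[of "{}" Z] assms by simp
  also have "\<dots> \<le> (\<Prod>z\<in>Z. 1 - exp (- C * T))"
    using empty_prob_bounds by (intro prod_mono) (auto simp: algebra_simps)
  finally show ?thesis by simp
qed

text \<open>An edge is named by its left end. A block containing {- K..K} may be cut at - K - 1 but
  no later on the left, and at K but no earlier on the right, hence the asymmetric ranges.\<close>

definition separated :: "int \<Rightarrow> nat \<Rightarrow> 'a set" where
  "separated K m = {\<omega> \<in> space M. (\<exists>z\<in>{- K - int m..<- K}. evs (\<lambda>z. P z \<omega>) T z = {}) \<and>
     (\<exists>z\<in>{K..<K + int m}. evs (\<lambda>z. P z \<omega>) T z = {})}"

lemma sets_separated: "separated K m \<in> sets M"
proof -
  have "Measurable.pred M (\<lambda>\<omega>. (\<exists>z\<in>{- K - int m..<- K}. evs (\<lambda>z. P z \<omega>) T z = {}) \<and>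
     (\<exists>z\<in>{K..<K + int m}. evs (\<lambda>z. P z \<omega>) T z = {}))"
    using measurable_evs(2) by (intro pred_intros_logic(3) pred_intros_finite(4)) auto
  then show ?thesis by (simp only: pred_def separated_def)
qed

lemma prob_not_separated: "1 - measure M (separated K m) \<le> 2 * (1 - exp (- C * T)) ^ m"
proof -
  define L where "L Y = {\<omega> \<in> space M. \<forall>z\<in>Y. evs (\<lambda>z. P z \<omega>) T z \<noteq> {}}" for Y
  have L_sets: "L Y \<in> sets M" if "finite Y" for Y
    using sets_empty_nonempty[of "{}" Y] that by (simp add: L_def)
  have "1 - measure M (separated K m) = measure M (space M - separated K m)"
    by (simp add: prob_compl sets_separated)
  also have "space M - separated K m \<subseteq> L {- K - int m..<- K} \<union> L {K..<K + int m}"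
    by (auto simp: separated_def L_def)
  then have "measure M (space M - separated K m) \<le> measure M (L {- K - int m..<- K} \<union> L {K..<K + int m})"
    by (intro finite_measure_mono) (auto simp: L_sets)
  also have "\<dots> \<le> measure M (L {- K - int m..<- K}) + measure M (L {K..<K + int m})"
    by (intro measure_Un_le L_sets) auto
  also have "\<dots> \<le> (1 - exp (- C * T)) ^ m + (1 - exp (- C * T)) ^ m"
    using prob_nonempty_le[of "{- K - int m..<- K}"] prob_nonempty_le[of "{K..<K + int m}"]
    unfolding L_def by (intro add_mono) simp_all
  finally show ?thesis by simp
qed

end

lemma prod_ge_one_minus_sum:
  fixes p :: "nat \<Rightarrow> real"
  assumes "\<And>i. i < n \<Longrightarrow> 0 \<le> p i \<and> p i \<le> 1"
  shows "1 - (\<Sum>i<n. 1 - p i) \<le> (\<Prod>i<n. p i) \<and> (\<Prod>i<n. p i) \<le> 1"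
  using assms
proof (induction n)
  case (Suc n)
  let ?x = "\<Prod>i<n. p i"
  have IH: "1 - (\<Sum>i<n. 1 - p i) \<le> ?x \<and> ?x \<le> 1" using Suc by auto
  have p: "0 \<le> p n" "p n \<le> 1" using Suc.prems by auto
  have x: "0 \<le> ?x" using Suc.prems by (auto intro!: prod_nonneg)
  have "0 \<le> (1 - ?x) * (1 - p n)" using IH p by simp
  then have "?x + p n - 1 \<le> ?x * p n" by (simp add: algebra_simps)
  moreover have "?x * p n \<le> 1" using IH p x by (simp add: mult_le_one)
  ultimately show ?case using IH by simp
qed simp

section \<open>Replacing events by finite sums over words\<close>

context cells
begin

lemma cell_event_nth_iff:
  assumes "\<omega> \<in> cell_event x c" "z \<in> Z" "i < n"
  shows "x ! i = Some (z, b) \<longleftrightarrow> P z \<omega> \<inter> (B i \<times> marks b) \<noteq> {}"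
proof -
  have "finite (P z \<omega> \<inter> (B i \<times> marks b)) \<and>
      card (P z \<omega> \<inter> (B i \<times> marks b)) = of_bool (x ! i = Some (z, b))"
    using assms unfolding cell_event_def by blast
  then show ?thesis by (cases "x ! i = Some (z, b)") auto
qed

lemma cell_event_disjoint:
  assumes "\<omega> \<in> cell_event x c" "\<omega> \<in> cell_event x' c'"
    and "x \<in> words Z n" "x' \<in> words Z n" "length c = k" "length c' = k"
  shows "x = x' \<and> c = c'"
proof
  have len: "length x = n" "length x' = n" using assms by (auto simp: words_def)
  show "x = x'"
  proof (rule nth_equalityI)
    fix i assume "i < length x"
    then have i: "i < n" by (simp add: len)
    have iff: "x ! i = Some (z, b) \<longleftrightarrow> x' ! i = Some (z, b)" if "z \<in> Z" for z b
      using cell_event_nth_iff[OF assms(1) that i] cell_event_nth_iff[OF assms(2) that i] by simp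
    have "x ! i \<in> letters Z" "x' ! i \<in> letters Z"
      using assms(3,4) i words_nth by blast+
    then have "x ! i = Some e \<longleftrightarrow> x' ! i = Some e" for e
      using iff[of "fst e" "snd e"] by (cases "fst e \<in> Z") (auto simp: letters_def)
    then show "x ! i = x' ! i" by (metis not_None_eq)
  qed (simp add: len)
  show "c = c'"
    using assms by (auto simp: cell_event_def intro!: nth_equalityI)
qed

text \<open>Every cell holds at most one ring of the window and cells are ordered in time, so
  listing the rings by cell already sorts them by \<open>before\<close>.\<close>

lemma cell_event_word:
  assumes \<omega>: "\<omega> \<in> cell_event x c" and x: "x \<in> words Z n"
  shows "finite (block_points (\<lambda>z. P z \<omega>) T lo hi)"
    and "block_word q (\<lambda>z. P z \<omega>) T lo hi = decode x"
proof -
  define I where "I = filter (\<lambda>i. x ! i \<noteq> None) [0..<n]"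
  \<comment> \<open>Prepares a choice function giving the ring of each nonempty cell; at empty cells
    its value is arbitrary.\<close>
  have "\<forall>i. \<exists>e. i < n \<longrightarrow> (\<forall>z b. x ! i = Some (z, b) \<longrightarrow>
      z \<in> Z \<and> (\<exists>u m. e = (u, z, m) \<and> P z \<omega> \<inter> (B i \<times> marks b) = {(u, m)}))"
  proof
    fix i
    show "\<exists>e. i < n \<longrightarrow> (\<forall>z b. x ! i = Some (z, b) \<longrightarrow>
      z \<in> Z \<and> (\<exists>u m. e = (u, z, m) \<and> P z \<omega> \<inter> (B i \<times> marks b) = {(u, m)}))"
    proof (cases "i < n \<and> x ! i \<noteq> None")
      case True
      then obtain z b where zb: "x ! i = Some (z, b)" by auto
      moreover have "x ! i \<in> letters Z" using words_nth[OF x] True by blast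
      ultimately have "z \<in> Z" by (auto simp: letters_def)
      then have "card (P z \<omega> \<inter> (B i \<times> marks b)) = 1"
        using \<omega> True zb by (auto simp: cell_event_def)
      then obtain p where "P z \<omega> \<inter> (B i \<times> marks b) = {p}" by (rule card_1_singletonE)
      then show ?thesis using zb \<open>z \<in> Z\<close> by (intro exI[of _ "(fst p, z, snd p)"]) auto
    qed auto
  qed
  from choice[OF this] obtain pt where pt: "\<And>i z b. i < n \<Longrightarrow> x ! i = Some (z, b) \<Longrightarrow>
      z \<in> Z \<and> (\<exists>u m. pt i = (u, z, m) \<and> P z \<omega> \<inter> (B i \<times> marks b) = {(u, m)})" by blast
  have pt': "\<exists>u z m b. pt i = (u, z, m) \<and> x ! i = Some (z, b) \<and> z \<in> Z \<and> (u, m) \<in> P z \<omega> \<and> u \<in> B i \<and> m \<in> marks b"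
    if i: "i < n" "x ! i \<noteq> None" for i
  proof -
    from i obtain z b where zb: "x ! i = Some (z, b)" by auto
    from pt[OF i(1) this] show ?thesis using zb by blast
  qed
  have sorted: "sorted_wrt before (map pt I)"
    unfolding sorted_wrt_map I_def
  proof (rule sorted_wrt_mono_rel)
    show "sorted_wrt (<) (filter (\<lambda>i. x ! i \<noteq> None) [0..<n])"
      by (simp add: sorted_wrt_filter)
    fix i j assume "i \<in> set (filter (\<lambda>i. x ! i \<noteq> None) [0..<n])" "j \<in> set (filter (\<lambda>i. x ! i \<noteq> None) [0..<n])" "i < j"
    then show "before (pt i) (pt j)"
      using pt'[of i] pt'[of j] B_less[of i j] by (fastforce simp: before_def)
  qed
  have set: "set (map pt I) = block_points (\<lambda>z. P z \<omega>) T lo hi"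
  proof (intro subset_antisym subsetI)
    fix e assume "e \<in> set (map pt I)"
    then obtain i where i: "e = pt i" "i < n" "x ! i \<noteq> None" by (auto simp: I_def)
    from pt'[OF i(2,3)] show "e \<in> block_points (\<lambda>z. P z \<omega>) T lo hi"
      using B_sub[OF i(2)] q
      by (auto simp: block_points_def evs_def i(1) marks_def split: if_splits)
  next
    fix e assume e: "e \<in> block_points (\<lambda>z. P z \<omega>) T lo hi"
    obtain u z m where euzm: "e = (u, z, m)" by (metis prod_cases3)
    then have *: "z \<in> Z" "(u, m) \<in> P z \<omega>" "u \<in> {0..T}" "0 \<le> m" "m \<le> 1"
      using e by (auto simp: block_points_def evs_def)
    obtain i where i: "i < n" "u \<in> B i" using B_cover *(3) by blast
    have m: "m \<in> marks (m < q)" using * by (simp add: marks_def)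
    then have xi: "x ! i = Some (z, m < q)"
      using cell_event_nth_iff[OF \<omega> *(1) i(1)] * i by blast
    from pt[OF i(1) xi] obtain u' m' where pti: "pt i = (u', z, m')"
      "P z \<omega> \<inter> (B i \<times> marks (m < q)) = {(u', m')}" by blast
    have "(u, m) \<in> P z \<omega> \<inter> (B i \<times> marks (m < q))" using * i m by blast
    then have "pt i = e" using pti by (simp add: euzm)
    then show "e \<in> set (map pt I)" using i xi by (auto simp: I_def)
  qed
  show fin: "finite (block_points (\<lambda>z. P z \<omega>) T lo hi)" unfolding set[symmetric] by simp
  have "block_word q (\<lambda>z. P z \<omega>) T lo hi = map (\<lambda>(u, z, m). (z, m < q)) (map pt I)"
    unfolding block_word_def block_events_eq[OF fin] ordered_list_eqI[OF sorted set] ..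
  also have "\<dots> = map (\<lambda>i. the (x ! i)) I"
    unfolding map_map
  proof (rule map_cong[OF refl])
    fix i assume "i \<in> set I"
    then have "i < n" "x ! i \<noteq> None" by (auto simp: I_def)
    from pt'[OF this] show "((\<lambda>(u, z, m). (z, m < q)) \<circ> pt) i = the (x ! i)"
      by (auto simp: marks_def split: if_splits)
  qed
  also have "\<dots> = decode (map ((!) x) [0..<n])"
    by (simp add: decode_def I_def filter_map o_def)
  also have "map ((!) x) [0..<n] = x" using x by (auto simp: words_def map_nth)
  finally show "block_word q (\<lambda>z. P z \<omega>) T lo hi = decode x" .
qed

lemma cell_event_coins:
  assumes "\<omega> \<in> cell_event x c" "length c = k"
  shows "map (\<lambda>i. U i \<omega> < q) [0..<k] = c"
  using assms by (auto simp: cell_event_def intro: nth_equalityI)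

text \<open>The part of an event that is visible from word and coins.
  \<open>select (\<lambda>_ _. True)\<close> is the good event that no cell contains more than one
  ring of the window.\<close>

definition select :: "((int \<times> bool) option list \<Rightarrow> bool list \<Rightarrow> bool) \<Rightarrow> 'a set" where
  "select Q = (\<Union>(x, c)\<in>{(x, c). x \<in> words Z n \<and> length c = k \<and> Q x c}. cell_event x c)"

lemma mem_select_iff:
  "\<omega> \<in> select Q \<longleftrightarrow> (\<exists>x c. x \<in> words Z n \<and> length c = k \<and> Q x c \<and> \<omega> \<in> cell_event x c)"
  unfolding select_def by blast

lemma select:
  shows sets_select: "select Q \<in> sets M"
    and measure_select: "measure M (select Q) =
      (\<Sum>x\<in>words Z n. \<Sum>c | length c = k.
        prod_list (map2 (letter_weight q) (map cell_letter [0..<n]) x) *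
        (prod_list (map (coin_weight q) c) * of_bool (Q x c)))"
proof -
  define X where "X = {(x, c :: bool list). x \<in> words Z n \<and> length c = k \<and> Q x c}"
  define w where "w x c = prod_list (map2 (letter_weight q) (map cell_letter [0..<n]) x) *
      prod_list (map (coin_weight q) c)" for x c
  have sub: "X \<subseteq> words Z n \<times> {c. length c = k}" by (auto simp: X_def)
  have fin: "finite (words Z n \<times> {c :: bool list. length c = k})"
    by (intro finite_cartesian_product finite_words finite_coins) auto
  have finX: "finite X" using finite_subset[OF sub fin] .
  have ev: "(case e of (x, c) \<Rightarrow> cell_event x c) \<in> sets M" if "e \<in> X" for e
    using that cell_event(1) by (auto simp: X_def)
  show "select Q \<in> sets M"
    unfolding select_def X_def[symmetric] using finX ev by (rule sets.finite_UN)
  have "measure M (select Q) = (\<Sum>e\<in>X. measure M (case e of (x, c) \<Rightarrow> cell_event x c))"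
    unfolding select_def X_def[symmetric]
  proof (rule finite_measure_finite_Union[OF finX])
    show "(\<lambda>e. case e of (x, c) \<Rightarrow> cell_event x c) ` X \<subseteq> sets M" using ev by auto
    show "disjoint_family_on (\<lambda>e. case e of (x, c) \<Rightarrow> cell_event x c) X"
      using cell_event_disjoint by (fastforce simp: disjoint_family_on_def X_def)
  qed
  also have "\<dots> = (\<Sum>e\<in>X. w (fst e) (snd e) * of_bool (Q (fst e) (snd e)))"
  proof (rule sum.cong[OF refl])
    fix e assume "e \<in> X"
    then have "fst e \<in> words Z n" "length (snd e) = k" "Q (fst e) (snd e)" by (auto simp: X_def)
    then show "measure M (case e of (x, c) \<Rightarrow> cell_event x c) =
        w (fst e) (snd e) * of_bool (Q (fst e) (snd e))"
      using cell_event(2) by (simp add: case_prod_beta w_def)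
  qed
  also have "\<dots> = (\<Sum>e\<in>words Z n \<times> {c. length c = k}. w (fst e) (snd e) * of_bool (Q (fst e) (snd e)))"
    by (rule sum.mono_neutral_left[OF fin sub]) (auto simp: X_def)
  also have "\<dots> = (\<Sum>x\<in>words Z n. \<Sum>c | length c = k. w x c * of_bool (Q x c))"
    by (simp add: sum.cartesian_product case_prod_beta)
  finally show "measure M (select Q) = (\<Sum>x\<in>words Z n. \<Sum>c | length c = k.
      prod_list (map2 (letter_weight q) (map cell_letter [0..<n]) x) *
      (prod_list (map (coin_weight q) c) * of_bool (Q x c)))"
    by (simp add: w_def mult.assoc)
qed

lemma sum_coin_weights: "(\<Sum>c | length c = k. prod_list (map (coin_weight q) c)) = 1"
proof -
  \<comment> \<open>The edges are dummies: the total weight of the coins is read off from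
    \<open>sum_coins\<close> with a constant observable.\<close>
  have "(\<Sum>c | length c = length ss. prod_list (map (coin_weight q) c)) = 1" for ss :: "int list"
    using sum_coins[where Z = "set ss" and ss = ss and q = q and f = "\<lambda>_. 1" and \<eta> = id] by (simp add: foldr_opR_one)
      (simp add: swap_letter_def prod_list_eq_prod_nth sum.delta')
  from this[of "replicate k 0"] show ?thesis by simp
qed

text \<open>A cell of total mass \<mu> is good with probability exp (- \<mu>) (1 + \<mu>), at least
  (1 - \<mu>) (1 + \<mu>); hence a loss of at most \<open>\<mu>\<^sup>2\<close> per cell, and the
  losses add up. The bound is quadratic in the cell length, which beats the number of cells.\<close>

lemma prob_select_all:
  assumes d: "\<And>i z. i < n \<Longrightarrow> mass rate z (B i) \<le> d"
  shows "1 - measure M (select (\<lambda>_ _. True)) \<le> real n * (real (card Z) * d)\<^sup>2"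
proof -
  define \<mu> where "\<mu> i = (\<Sum>z\<in>Z. mass rate z (B i))" for i
  have \<mu>0: "0 \<le> \<mu> i" for i by (simp add: \<mu>_def sum_nonneg mass_nonneg)
  have \<mu>d: "\<mu> i \<le> real (card Z) * d" if "i < n" for i
    using sum_bounded_above[of Z "\<lambda>z. mass rate z (B i)" d] d[OF that] by (simp add: \<mu>_def)
  define p where "p i = exp (- \<mu> i) * (1 + \<mu> i)" for i
  have letter: "cell_letter i None + (\<Sum>z\<in>Z. cell_letter i (Some z)) = p i" for i
    by (simp add: cell_letter_def p_def \<mu>_def exp_sum[symmetric] sum_negf distrib_left sum_distrib_left)
  have "measure M (select (\<lambda>_ _. True)) =
      (\<Sum>x\<in>words Z n. prod_list (map2 (letter_weight q) (map cell_letter [0..<n]) x))"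
    unfolding measure_select by (simp add: sum_distrib_left[symmetric] sum_coin_weights)
  also have "\<dots> = (\<Prod>i<n. p i)"
    using sum_words[where Z = Z and as = "map cell_letter [0..<n]" and q = q and f = "\<lambda>_. 1" and \<eta> = id]
    by (simp add: foldr_opR_one letter prod_list_eq_prod_nth)
  finally have eq: "measure M (select (\<lambda>_ _. True)) = (\<Prod>i<n. p i)" .
  have p: "0 \<le> p i \<and> p i \<le> 1" "1 - p i \<le> (\<mu> i)\<^sup>2" for i
  proof -
    have "1 + \<mu> i \<le> exp (\<mu> i)" by (rule exp_ge_add_one_self)
    then have "p i \<le> exp (- \<mu> i) * exp (\<mu> i)" unfolding p_def by (intro mult_left_mono) auto
    then show "0 \<le> p i \<and> p i \<le> 1" using \<mu>0[of i] by (simp add: p_def exp_minus)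
    have "1 - \<mu> i \<le> exp (- \<mu> i)" using exp_ge_add_one_self[of "- \<mu> i"] by simp
    then have "(1 - \<mu> i) * (1 + \<mu> i) \<le> p i" unfolding p_def using \<mu>0[of i] by (intro mult_right_mono) auto
    then show "1 - p i \<le> (\<mu> i)\<^sup>2" by (simp add: algebra_simps power2_eq_square)
  qed
  have "1 - (\<Prod>i<n. p i) \<le> (\<Sum>i<n. 1 - p i)"
    using prod_ge_one_minus_sum[of n p] p(1) by force
  also have "\<dots> \<le> (\<Sum>i<n. (real (card Z) * d)\<^sup>2)"
    using \<mu>0 \<mu>d p(2) by (intro sum_mono order_trans[OF p(2)] power_mono) auto
  finally show ?thesis by (simp add: eq)
qed

text \<open>A and \<open>select Q\<close> differ at most where separation fails or some cell has
  several rings, so the description by words is required on the good event only.\<close>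

lemma measure_approx_select:
  assumes A: "A \<in> sets M"
    and iff: "\<And>\<omega> x c. \<omega> \<in> separated K m \<Longrightarrow> x \<in> words Z n \<Longrightarrow> length c = k \<Longrightarrow>
      \<omega> \<in> cell_event x c \<Longrightarrow> \<omega> \<in> A \<longleftrightarrow> Q x c"
  shows "\<bar>measure M A - measure M (select Q)\<bar> \<le>
    (1 - measure M (separated K m)) + (1 - measure M (select (\<lambda>_ _. True)))"
proof -
  define N where "N = (space M - separated K m) \<union> (space M - select (\<lambda>_ _. True))"
  have N: "N \<in> sets M" using sets_separated sets_select by (auto simp: N_def)
  have "measure M N \<le> measure M (space M - separated K m) + measure M (space M - select (\<lambda>_ _. True))"
    unfolding N_def using sets_separated sets_select by (intro measure_Un_le) auto
  then have N_le: "measure M N \<le> (1 - measure M (separated K m)) + (1 - measure M (select (\<lambda>_ _. True)))"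
    by (simp add: prob_compl sets_separated sets_select)
  have "A \<subseteq> select Q \<union> N"
  proof
    fix \<omega> assume "\<omega> \<in> A"
    show "\<omega> \<in> select Q \<union> N"
    proof (cases "\<omega> \<in> N")
      case False
      then have "\<omega> \<in> separated K m" "\<omega> \<in> select (\<lambda>_ _. True)"
        using sets.sets_into_space[OF A] \<open>\<omega> \<in> A\<close> by (auto simp: N_def)
      then obtain x c where xc: "x \<in> words Z n" "length c = k" "\<omega> \<in> cell_event x c"
        unfolding mem_select_iff by blast
      have "Q x c" using iff[OF \<open>\<omega> \<in> separated K m\<close> xc] \<open>\<omega> \<in> A\<close> by simp
      then show ?thesis using xc unfolding Un_iff mem_select_iff by blast
    qed simp
  qed
  then have 1: "measure M A \<le> measure M (select Q) + measure M N"
    by (intro order_trans[OF finite_measure_mono measure_Un_le]) (auto simp: N sets_select)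
  have "select Q \<subseteq> A \<union> N"
  proof
    fix \<omega> assume \<omega>: "\<omega> \<in> select Q"
    show "\<omega> \<in> A \<union> N"
    proof (cases "\<omega> \<in> N")
      case False
      then have "\<omega> \<in> separated K m"
        using sets.sets_into_space[OF sets_select[of Q]] \<omega> by (auto simp: N_def)
      moreover obtain x c where xc: "x \<in> words Z n" "length c = k" "\<omega> \<in> cell_event x c" "Q x c"
        using \<omega> unfolding mem_select_iff by blast
      ultimately have "\<omega> \<in> A" using iff[OF _ xc(1-3)] by simp
      then show ?thesis by simp
    qed simp
  qed
  then have "measure M (select Q) \<le> measure M A + measure M N"
    by (intro order_trans[OF finite_measure_mono measure_Un_le]) (auto simp: N A)
  then show ?thesis using 1 N_le by linarith
qed

end

text \<open>The preimage of y lies in A because \<zeta> maps A onto itself, and on A the two maps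
  agree.\<close>

lemma inv_eq_on_block:
  assumes "bij \<zeta>" "bij \<zeta>'" "\<And>v. v \<in> A \<Longrightarrow> \<zeta> v = \<zeta>' v" "\<zeta> ` A = A" "y \<in> A"
  shows "inv \<zeta> y = inv \<zeta>' y"
proof -
  obtain v where v: "v \<in> A" "y = \<zeta> v" using assms(4,5) by blast
  have "inv \<zeta> y = v" unfolding v(2) using assms(1) by (simp add: bij_is_inj inv_f_f)
  moreover have "inv \<zeta>' y = v"
    unfolding v(2) assms(3)[OF v(1)] using assms(2) by (simp add: bij_is_inj inv_f_f)
  ultimately show ?thesis by simp
qed

context cells
begin

lemma separated_window:
  assumes "0 \<le> K" "lo = - K - int m" "hi = K + int m"
    and sep: "\<omega> \<in> separated K m" and \<omega>: "\<omega> \<in> cell_event x c" and x: "x \<in> words Z n"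
  shows "\<exists>a b. a \<le> - K \<and> K \<le> b \<and>
    (\<forall>\<xi>. \<forall>y\<in>{a..b}. asep q (\<lambda>z. P z \<omega>) T \<xi> y = run_word (decode x) \<xi> y) \<and>
    (\<forall>\<xi>. run_word (decode x) \<xi> ` {a..b} = \<xi> ` {a..b})"
proof -
  obtain a' b where ab: "a' \<in> {- K - int m..<- K}" "evs (\<lambda>z. P z \<omega>) T a' = {}"
      "b \<in> {K..<K + int m}" "evs (\<lambda>z. P z \<omega>) T b = {}"
    using sep unfolding separated_def by blast
  \<comment> \<open>The silent edge joins a' and a' + 1, so the block begins at its right
    end.\<close>
  define a where "a = a' + 1"
  have *: "lo \<le> a" "a \<le> - K" "K \<le> b" "b \<le> hi" "a \<le> b" "evs (\<lambda>z. P z \<omega>) T (a - 1) = {}"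
    using ab assms(1-3) by (auto simp: a_def)
  note fin = cell_event_word(1)[OF \<omega> x]
  note word = cell_event_word(2)[OF \<omega> x]
  show ?thesis
  proof (intro exI conjI allI ballI)
    show "a \<le> - K" "K \<le> b" by fact+
  next
    fix \<xi> y assume "y \<in> {a..b}"
    then show "asep q (\<lambda>z. P z \<omega>) T \<xi> y = run_word (decode x) \<xi> y"
      using asep_window[OF fin *(1,4,5,6) ab(4)] by (simp add: word)
  next
    fix \<xi>
    show "run_word (decode x) \<xi> ` {a..b} = \<xi> ` {a..b}"
      using block_word_image[OF fin *(6) ab(4), of q \<xi>] by (simp add: word)
  qed
qed

lemma process1_eq_word:
  assumes "0 \<le> K" "lo = - K - int m" "hi = K + int m"
    and "\<omega> \<in> separated K m" "x \<in> words Z n" "\<omega> \<in> cell_event x c"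
    and k: "k = length ss" "length c = k" and y: "y \<in> {- K..K}"
  shows "process1 q T ss P U \<omega> y = run_word (decode x) (run_word (zip ss c) id) y"
proof -
  obtain a b where ab: "a \<le> - K" "K \<le> b"
    and asep: "\<And>\<xi> y. y \<in> {a..b} \<Longrightarrow> asep q (\<lambda>z. P z \<omega>) T \<xi> y = run_word (decode x) \<xi> y"
    and "\<And>\<xi>. run_word (decode x) \<xi> ` {a..b} = \<xi> ` {a..b}"
    using separated_window[OF assms(1-4,6,5)] by blast
  have coins: "map (\<lambda>c. c < q) (map (\<lambda>i. U i \<omega>) [0..<length ss]) = c"
    using cell_event_coins[OF assms(6) k(2)] unfolding k(1) map_map o_def .
  have "y \<in> {a..b}" using y ab by auto
  then show ?thesis
    unfolding process1_def apply_swaps_eq_run_word coins by (rule asep)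
qed

text \<open>The final swaps lie within {- K..K} and so do not cross the ends of the block. ASEP and
  swaps together map the block onto itself, and the inverse at y is found without looking
  outside.\<close>

lemma inv_process2_eq_word:
  assumes "0 \<le> K" "lo = - K - int m" "hi = K + int m"
    and "\<omega> \<in> separated K m" "x \<in> words Z n" "\<omega> \<in> cell_event x c"
    and k: "k = length ss" "length c = k" and y: "y \<in> {- K..K}"
    and ss: "\<And>s. s \<in> set ss \<Longrightarrow> - K \<le> s \<and> s < K"
  shows "inv (process2 q T ss P U \<omega>) y =
    inv (run_word (zip (rev ss) c) (run_word (decode x) id)) y"
proof -
  obtain a b where ab: "a \<le> - K" "K \<le> b"
    and asep: "\<And>\<xi> y. y \<in> {a..b} \<Longrightarrow> asep q (\<lambda>z. P z \<omega>) T \<xi> y = run_word (decode x) \<xi> y"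
    and image: "\<And>\<xi>. run_word (decode x) \<xi> ` {a..b} = \<xi> ` {a..b}"
    using separated_window[OF assms(1-4,6,5)] by blast
  let ?w = "zip (rev ss) c" and ?\<eta> = "asep q (\<lambda>z. P z \<omega>) T id" and ?\<eta>' = "run_word (decode x) id"
  have w: "\<forall>(z, d)\<in>set ?w. z \<noteq> a - 1 \<and> z \<noteq> b"
  proof clarify
    fix z d assume "(z, d) \<in> set ?w"
    then have "z \<in> set ss" by (auto dest: set_zip_leftD)
    then show "z \<noteq> a - 1 \<and> z \<noteq> b" using ss[of z] ab by auto
  qed
  \<comment> \<open>Both runs coincide on the block with the run of the filtered word from
    \<open>?\<eta>'\<close>.\<close>
  have agree: "run_word ?w ?\<eta> v = run_word ?w ?\<eta>' v" if v: "v \<in> {a..b}" for v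
    using run_word_agree[OF w _ v, of ?\<eta> ?\<eta>'] run_word_agree[OF w _ v, of ?\<eta>' ?\<eta>'] asep by simp
  have "?\<eta> ` {a..b} = ?\<eta>' ` {a..b}" using asep by (intro image_cong) auto
  then have "run_word ?w ?\<eta> ` {a..b} = {a..b}"
    using run_word_image[OF w, of ?\<eta>] image[of id] by simp
  then have "inv (run_word ?w ?\<eta>) y = inv (run_word ?w ?\<eta>') y"
    using agree y ab
    by (intro inv_eq_on_block[where A = "{a..b}"]) (auto intro!: bij_run_word bij_asep)
  moreover have coins: "map (\<lambda>c. c < q) (map (\<lambda>i. U i \<omega>) [0..<length ss]) = c"
    using cell_event_coins[OF assms(6) k(2)] unfolding k(1) map_map o_def .
  ultimately show ?thesis unfolding process2_def apply_swaps_eq_run_word coins by blast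
qed

text \<open>The coins act first in time, hence their operators stand outermost. The sum over words
  has to be carried out inside the sum over coins, which explains the exchange of sums.\<close>

lemma measure_select_coins_first:
  assumes k: "k = length ss" and ss: "set ss \<subseteq> Z"
  shows "measure M (select (\<lambda>x c. Q (run_word (decode x) (run_word (zip ss c) id)))) =
    foldr (opR q Z) (map swap_letter ss @ map cell_letter [0..<n]) (\<lambda>\<eta>. of_bool (Q \<eta>)) id"
proof -
  let ?f = "\<lambda>\<eta>. of_bool (Q \<eta>) :: real"
  have words: "(\<Sum>x\<in>words Z n. prod_list (map2 (letter_weight q) (map cell_letter [0..<n]) x) *
      ?f (run_word (decode x) \<xi>)) = foldr (opR q Z) (map cell_letter [0..<n]) ?f \<xi>" for \<xi>
    using sum_words[where Z = Z and as = "map cell_letter [0..<n]" and q = q and f = ?f and \<eta> = \<xi>]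
    by (simp only: length_map length_upt diff_zero finite_atLeastLessThan_int)
  have "measure M (select (\<lambda>x c. Q (run_word (decode x) (run_word (zip ss c) id)))) =
      (\<Sum>c | length c = k. prod_list (map (coin_weight q) c) *
        (\<Sum>x\<in>words Z n. prod_list (map2 (letter_weight q) (map cell_letter [0..<n]) x) *
          ?f (run_word (decode x) (run_word (zip ss c) id))))"
    unfolding measure_select by (subst sum.swap) (simp only: sum_distrib_left mult.left_commute)
  also have "\<dots> = foldr (opR q Z) (map swap_letter ss)
      (foldr (opR q Z) (map cell_letter [0..<n]) ?f) id"
    unfolding words k by (rule sum_coins) (use ss in auto)
  finally show ?thesis by (simp only: foldr_append o_apply)
qed

lemma measure_select_words_first:
  assumes k: "k = length ss" and ss: "set ss \<subseteq> Z"
  shows "measure M (select (\<lambda>x c. Q (run_word (zip ss c) (run_word (decode x) id)))) =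
    foldr (opR q Z) (map cell_letter [0..<n] @ map swap_letter ss) (\<lambda>\<eta>. of_bool (Q \<eta>)) id"
proof -
  let ?f = "\<lambda>\<eta>. of_bool (Q \<eta>) :: real"
  have coins: "(\<Sum>c | length c = k. prod_list (map (coin_weight q) c) * ?f (run_word (zip ss c) \<xi>)) =
      foldr (opR q Z) (map swap_letter ss) ?f \<xi>" for \<xi>
    unfolding k by (rule sum_coins) (use ss in auto)
  have "measure M (select (\<lambda>x c. Q (run_word (zip ss c) (run_word (decode x) id)))) =
      (\<Sum>x\<in>words Z n. prod_list (map2 (letter_weight q) (map cell_letter [0..<n]) x) *
        (\<Sum>c | length c = k. prod_list (map (coin_weight q) c) *
          ?f (run_word (zip ss c) (run_word (decode x) id))))"
    unfolding measure_select by (simp only: sum_distrib_left)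
  also have "\<dots> = foldr (opR q Z) (map cell_letter [0..<n]) (foldr (opR q Z) (map swap_letter ss) ?f) id"
    unfolding coins
    using sum_words[where Z = Z and as = "map cell_letter [0..<n]" and q = q
        and f = "foldr (opR q Z) (map swap_letter ss) ?f" and \<eta> = id]
    by (simp only: length_map length_upt diff_zero finite_atLeastLessThan_int)
  finally show ?thesis by (simp only: foldr_append o_apply)
qed

end

section \<open>The time grid and its reflection\<close>

definition time_cell :: "real \<Rightarrow> nat \<Rightarrow> nat \<Rightarrow> real set" where
  "time_cell T N i = {u \<in> {0..T}. \<lfloor>real N * u\<rfloor> = int i}"

text \<open>The cell indices run from 0 up to and including the floor of N T.\<close>

definition cell_count :: "real \<Rightarrow> nat \<Rightarrow> nat" where
  "cell_count T N = nat \<lfloor>real N * T\<rfloor> + 1"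

lemma time_cell_cover: "{0..T} \<subseteq> (\<Union>i<cell_count T N. time_cell T N i)"
proof
  fix u assume u: "u \<in> {0..T}"
  then have "0 \<le> \<lfloor>real N * u\<rfloor>" "\<lfloor>real N * u\<rfloor> \<le> \<lfloor>real N * T\<rfloor>"
    using floor_le_of_le[of u T N] by auto
  then have "nat \<lfloor>real N * u\<rfloor> < cell_count T N" "\<lfloor>real N * u\<rfloor> = int (nat \<lfloor>real N * u\<rfloor>)"
    unfolding cell_count_def by linarith+
  then show "u \<in> (\<Union>i<cell_count T N. time_cell T N i)" using u unfolding time_cell_def by blast
qed

lemma time_cell_less:
  assumes "i < j" "u \<in> time_cell T N i" "v \<in> time_cell T N j"
  shows "u < v"
proof (rule ccontr)
  assume "\<not> u < v"
  then have "\<lfloor>real N * v\<rfloor> \<le> \<lfloor>real N * u\<rfloor>" by (intro floor_le_of_le) auto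
  then show False using assms by (auto simp: time_cell_def)
qed

lemma time_cell_borel: "time_cell T N i \<in> sets borel"
proof -
  have "{u \<in> space borel. 0 \<le> u \<and> u \<le> T \<and> \<lfloor>real N * u\<rfloor> = int i} \<in> sets borel"
    by measurable
  then show ?thesis by (simp add: time_cell_def)
qed

lemma measure_time_cell_le:
  assumes "0 < N"
  shows "measure lborel (time_cell T N i) \<le> 1 / real N"
proof -
  have "time_cell T N i \<subseteq> {real i / real N..(real i + 1) / real N}"
    using assms by (auto simp: time_cell_def field_simps floor_eq_iff)
  then have "measure lborel (time_cell T N i) \<le> measure lborel {real i / real N..(real i + 1) / real N}"
    by (intro measure_mono_fmeasurable) (auto simp: time_cell_borel fmeasurable_def emeasure_lborel_Icc_eq)
  also have "\<dots> = 1 / real N" using assms by (simp add: field_simps)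
  finally show ?thesis .
qed

lemma (in rate_bound) mass_time_cell_le:
  assumes "0 < N"
  shows "mass rate z (time_cell T N i) \<le> C / real N"
proof -
  have "mass rate z (time_cell T N i) \<le> C * measure lborel (time_cell T N i)"
    by (rule mass_le) (auto simp: time_cell_borel time_cell_def)
  also have "\<dots> \<le> C * (1 / real N)"
    by (intro mult_left_mono measure_time_cell_le assms C_nonneg)
  finally show ?thesis by simp
qed

text \<open>The index is reversed together with time, so that the reflected cells are again numbered
  in increasing time.\<close>

definition reflected_cell :: "real \<Rightarrow> nat \<Rightarrow> nat \<Rightarrow> real set" where
  "reflected_cell T N i = {u. T - u \<in> time_cell T N (cell_count T N - 1 - i)}"

lemma cells_forward:
  assumes "bounded_clocks M T C rate P k U" "0 \<le> q" "q \<le> 1"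
  shows "cells M T C rate P k U q (time_cell T N) (cell_count T N)"
proof -
  interpret bounded_clocks M T C rate P k U by fact
  show ?thesis
  proof
    show "0 \<le> q" "q \<le> 1" by fact+
    show "{0..T} \<subseteq> (\<Union>i<cell_count T N. time_cell T N i)" by (rule time_cell_cover)
    fix i
    show "time_cell T N i \<in> sets borel" by (rule time_cell_borel)
    show "time_cell T N i \<subseteq> {0..T}" by (auto simp: time_cell_def)
    fix j u v assume "i < j" "u \<in> time_cell T N i" "v \<in> time_cell T N j"
    then show "u < v" by (rule time_cell_less)
  qed
qed

lemma cells_reflected:
  assumes "bounded_clocks M T C rate P k U" "0 \<le> q" "q \<le> 1"
  shows "cells M T C rate P k U q (reflected_cell T N) (cell_count T N)"
proof -
  interpret bounded_clocks M T C rate P k U by fact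
  show ?thesis
  proof
    fix i assume "i < cell_count T N"
    have "(\<lambda>u. T - u) -` time_cell T N (cell_count T N - 1 - i) \<inter> space borel \<in> sets borel"
      by (rule measurable_sets[OF _ time_cell_borel]) measurable
    then show "reflected_cell T N i \<in> sets borel"
      by (simp add: reflected_cell_def vimage_def)
    show "reflected_cell T N i \<subseteq> {0..T}"
      by (auto simp: reflected_cell_def time_cell_def)
  next
    show "{0..T} \<subseteq> (\<Union>i<cell_count T N. reflected_cell T N i)"
    proof
      fix u assume "u \<in> {0..T}"
      then have "T - u \<in> {0..T}" by auto
      then obtain j where j: "j < cell_count T N" "T - u \<in> time_cell T N j"
        using time_cell_cover by blast
      then have "u \<in> reflected_cell T N (cell_count T N - 1 - j)"
        by (simp add: reflected_cell_def)
      moreover have "cell_count T N - 1 - j < cell_count T N" using j by linarith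
      ultimately show "u \<in> (\<Union>i<cell_count T N. reflected_cell T N i)" by blast
    qed
  next
    fix i j u v assume "i < j" "j < cell_count T N" "u \<in> reflected_cell T N i" "v \<in> reflected_cell T N j"
    then have "T - v < T - u"
      by (intro time_cell_less[of "cell_count T N - 1 - j" "cell_count T N - 1 - i" _ T N])
        (auto simp: reflected_cell_def)
    then show "u < v" by simp
  qed fact+
qed

section \<open>Equality in distribution\<close>

context clocks
begin

lemma measurable_run_word_at:
  assumes "\<And>x y. Measurable.pred M (\<lambda>\<omega>. X \<omega> x = y)"
  shows "Measurable.pred M (\<lambda>\<omega>. run_word w (X \<omega>) x = y)"
  using assms
proof (induction w arbitrary: X)
  case Nil
  then show ?case by (simp only: run_word_simps)
next
  case (Cons e w)
  obtain z b where e: "e = (z, b)" by fastforce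
  have "Measurable.pred M (\<lambda>\<omega>. bswap z b (X \<omega>) x = y)" for x y
  proof -
    \<comment> \<open>The site from which x receives its color depends only on the two compared
      colors, so a countable union over their values suffices.\<close>
    define v where "v i j = (if i < j \<or> (j < i \<and> b) then adj z x else x)" for i j :: int
    have "Measurable.pred M (\<lambda>\<omega>. \<exists>i j. X \<omega> z = i \<and> X \<omega> (z + 1) = j \<and> X \<omega> (v i j) = y)"
      by (rule pred_intros_countable(2), rule pred_intros_countable(2),
          rule pred_intros_logic(3)[OF Cons.prems pred_intros_logic(3)[OF Cons.prems Cons.prems]])
    also have "(\<lambda>\<omega>. \<exists>i j. X \<omega> z = i \<and> X \<omega> (z + 1) = j \<and> X \<omega> (v i j) = y) =
        (\<lambda>\<omega>. bswap z b (X \<omega>) x = y)"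
      by (simp add: v_def bswap_def)
    finally show ?thesis .
  qed
  from Cons.IH[OF this] show ?case by (simp only: e run_word_simps)
qed

lemma process_coins:
  assumes "k = length ss"
  shows "process1 q T ss P U \<omega> =
      asep q (\<lambda>z. P z \<omega>) T (run_word (zip ss (map (\<lambda>i. U i \<omega> < q) [0..<k])) id)"
    and "process2 q T ss P U \<omega> =
      run_word (zip (rev ss) (map (\<lambda>i. U i \<omega> < q) [0..<k])) (asep q (\<lambda>z. P z \<omega>) T id)"
  unfolding process1_def process2_def apply_swaps_eq_run_word map_map o_def assms by (rule refl)+

lemma bij_process1: "k = length ss \<Longrightarrow> bij (process1 q T ss P U \<omega>)"
  unfolding process_coins by (intro bij_asep bij_run_word bij_id)

lemma bij_process2: "k = length ss \<Longrightarrow> bij (process2 q T ss P U \<omega>)"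
  unfolding process_coins by (intro bij_asep bij_run_word bij_id)

lemma measurable_process1:
  assumes k: "k = length ss"
  shows "process1 q T ss P U \<in> M \<rightarrow>\<^sub>M config_space"
proof (rule measurable_into_config_space)
  fix x y
  have "Measurable.pred M (\<lambda>\<omega>. \<exists>c. map (\<lambda>i. U i \<omega> < q) [0..<k] = c \<and>
      asep q (\<lambda>z. P z \<omega>) T (run_word (zip ss c) id) x = y)"
    by (rule pred_intros_countable(2), rule pred_intros_logic(3)[OF measurable_coins measurable_asep_at])
  then show "Measurable.pred M (\<lambda>\<omega>. process1 q T ss P U \<omega> x = y)"
    unfolding process_coins(1)[OF k] by simp
qed

lemma measurable_inv_process2:
  assumes k: "k = length ss"
  shows "(\<lambda>\<omega>. inv (process2 q T ss P U \<omega>)) \<in> M \<rightarrow>\<^sub>M config_space"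
proof (rule measurable_into_config_space)
  fix x y
  have "Measurable.pred M (\<lambda>\<omega>. \<exists>c. map (\<lambda>i. U i \<omega> < q) [0..<k] = c \<and>
      run_word (zip (rev ss) c) (asep q (\<lambda>z. P z \<omega>) T id) y = x)"
    by (rule pred_intros_countable(2), rule pred_intros_logic(3)[OF measurable_coins
          measurable_run_word_at[OF measurable_asep_at]])
  then have "Measurable.pred M (\<lambda>\<omega>. process2 q T ss P U \<omega> y = x)"
    unfolding process_coins(2)[OF k] by simp
  \<comment> \<open>As process 2 is bijective for every \<omega>, its inverse is tested through the
    process itself.\<close>
  also have "(\<lambda>\<omega>. process2 q T ss P U \<omega> y = x) = (\<lambda>\<omega>. inv (process2 q T ss P U \<omega>) x = y)"
    using bij_inv_eq_iff[OF bij_process2[OF k]] by metis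
  finally show "Measurable.pred M (\<lambda>\<omega>. inv (process2 q T ss P U \<omega>) x = y)" .
qed

end

lemma sets_cylinder:
  assumes "X \<in> M \<rightarrow>\<^sub>M config_space" "finite J"
  shows "{\<omega> \<in> space M. \<forall>y\<in>J. X \<omega> y \<in> A y} \<in> sets M"
proof -
  have "Measurable.pred M (\<lambda>\<omega>. X \<omega> y \<in> A y)" for y
  proof -
    have "(\<lambda>\<omega>. X \<omega> y) \<in> M \<rightarrow>\<^sub>M count_space UNIV"
      using measurable_compose[OF assms(1)[unfolded config_space_def] measurable_component_singleton[of y]]
      by simp
    from measurable_sets[OF this, of "A y"] show ?thesis
      by (simp add: pred_def vimage_def Int_def conj_commute)
  qed
  then have "Measurable.pred M (\<lambda>\<omega>. \<forall>y\<in>J. X \<omega> y \<in> A y)"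
    by (intro pred_intros_finite(3) assms(2))
  then show ?thesis by (simp only: pred_def)
qed

lemma distr_config_space_eqI:
  assumes "prob_space M" "prob_space N"
    and X: "X \<in> M \<rightarrow>\<^sub>M config_space" and Y: "Y \<in> N \<rightarrow>\<^sub>M config_space"
    and eq: "\<And>J A. finite J \<Longrightarrow> measure M {\<omega> \<in> space M. \<forall>y\<in>J. X \<omega> y \<in> A y} =
      measure N {\<omega> \<in> space N. \<forall>y\<in>J. Y \<omega> y \<in> A y}"
  shows "distr M config_space X = distr N config_space Y"
proof -
  interpret M: prob_space M by fact
  interpret N: prob_space N by fact
  interpret MX: prob_space "distr M config_space X" by (rule M.prob_space_distr[OF X])
  show ?thesis
  proof (rule measure_eqI_PiM_infinite[where I = UNIV and M = "\<lambda>_. count_space UNIV"])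
    show "sets (distr M config_space X) = sets (PiM UNIV (\<lambda>_. count_space UNIV))"
      "sets (distr N config_space Y) = sets (PiM UNIV (\<lambda>_. count_space UNIV))"
      by (simp_all add: config_space_def)
    show "finite_measure (distr M config_space X)" by unfold_locales
    fix A :: "int \<Rightarrow> int set" and J :: "int set"
    assume J: "finite J"
    let ?E = "prod_emb UNIV (\<lambda>_. count_space UNIV) J (Pi\<^sub>E J A)"
    have E: "?E \<in> sets config_space"
      unfolding config_space_def using J by (intro sets_PiM_I) auto
    have "?E = {\<eta>. \<forall>y\<in>J. \<eta> y \<in> A y}"
      by (auto simp: prod_emb_def PiE_iff space_PiM)
    then have "X -` ?E \<inter> space M = {\<omega> \<in> space M. \<forall>y\<in>J. X \<omega> y \<in> A y}"
      "Y -` ?E \<inter> space N = {\<omega> \<in> space N. \<forall>y\<in>J. Y \<omega> y \<in> A y}" by auto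
    then show "emeasure (distr M config_space X) ?E = emeasure (distr N config_space Y) ?E"
      by (simp add: emeasure_distr[OF X E] emeasure_distr[OF Y E] M.emeasure_eq_measure
          N.emeasure_eq_measure eq[OF J])
  qed
qed

lemma mass_reflected_cell:
  "mass (\<lambda>z u. r z (T - u)) z (reflected_cell T N i) = mass r z (time_cell T N (cell_count T N - 1 - i))"
  unfolding reflected_cell_def by (rule mass_reflect)

text \<open>Here the time reversal of the rates enters: a reflected cell has under the reversed
  rates the mass of its mirror image under the original ones, so the list of cell weights is
  reversed.\<close>

lemma cell_letter_reflected:
  assumes I1: "cells M1 T C r P1 k1 U1 q (time_cell T N) (cell_count T N)"
    and I2: "cells M2 T C (\<lambda>z u. r z (T - u)) P2 k2 U2 q (reflected_cell T N) (cell_count T N)"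
  shows "map (cells.cell_letter (\<lambda>z u. r z (T - u)) lo hi (reflected_cell T N)) [0..<cell_count T N] =
    rev (map (cells.cell_letter r lo hi (time_cell T N)) [0..<cell_count T N])"
proof -
  have "cells.cell_letter (\<lambda>z u. r z (T - u)) lo hi (reflected_cell T N) i =
      cells.cell_letter r lo hi (time_cell T N) (cell_count T N - 1 - i)" for i
    unfolding cells.cell_letter_def[OF I1] cells.cell_letter_def[OF I2] mass_reflected_cell
    by (rule refl)
  then show ?thesis by (intro nth_equalityI) (auto simp: rev_nth)
qed

lemma abs_diff_le_of_common:
  fixes a b s :: real
  assumes "\<bar>a - s\<bar> \<le> x1 + y1" "\<bar>b - s\<bar> \<le> x2 + y2"
    and "x1 \<le> e" "x2 \<le> e" "y1 \<le> d" "y2 \<le> d"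
  shows "\<bar>a - b\<bar> \<le> 2 * e + 2 * d"
  using assms by linarith

text \<open>Either process differs from its description by words through a failure of separation, on
  two sides, or through several rings in a cell; the outer factors 2 count the processes. The two
  descriptions have equal probability by \<open>foldr_opR_rev\<close>.\<close>

lemma cylinder_estimate:
  assumes q: "0 \<le> q" "q \<le> 1"
    and B1: "bounded_clocks M1 T C r P1 (length ss) U1"
    and B2: "bounded_clocks M2 T C (\<lambda>z u. r z (T - u)) P2 (length ss) U2"
    and J: "finite J" "J \<subseteq> {- K..K}" and ss: "\<And>s. s \<in> set ss \<Longrightarrow> - K \<le> s \<and> s < K"
    and K: "0 \<le> K" and N: "0 < N"
  shows "\<bar>measure M1 {\<omega> \<in> space M1. \<forall>y\<in>J. process1 q T ss P1 U1 \<omega> y \<in> A y} -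
      measure M2 {\<omega> \<in> space M2. \<forall>y\<in>J. inv (process2 q T ss P2 U2 \<omega>) y \<in> A y}\<bar> \<le>
    2 * (2 * (1 - exp (- C * T)) ^ m) +
    2 * (real (cell_count T N) * (real (card {- K - int m..<K + int m}) * (C / real N))\<^sup>2)"
    (is "\<bar>measure M1 ?A1 - measure M2 ?A2\<bar> \<le> 2 * (2 * ?\<rho> ^ m) + 2 * ?err")
proof -
  define Q where "Q \<eta> \<longleftrightarrow> (\<forall>y\<in>J. \<eta> y \<in> A y)" for \<eta> :: config
  define lo hi where "lo = - K - int m" and "hi = K + int m"
  interpret I1: cells M1 T C r P1 "length ss" U1 q lo hi "time_cell T N" "cell_count T N"
    using cells_forward[OF B1 q] .
  interpret I2: cells M2 T C "\<lambda>z u. r z (T - u)" P2 "length ss" U2 q lo hi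
      "reflected_cell T N" "cell_count T N"
    using cells_reflected[OF B2 q] .
  define S1 where "S1 = I1.select (\<lambda>x c. Q (run_word (decode x) (run_word (zip ss c) id)))"
  define S2 where "S2 = I2.select (\<lambda>x c. Q (inv (run_word (zip (rev ss) c) (run_word (decode x) id))))"
  have set_ss: "set ss \<subseteq> {lo..<hi}" using ss by (force simp: lo_def hi_def)
  have "measure M2 S2 = foldr (opR q {lo..<hi})
      (map I2.cell_letter [0..<cell_count T N] @ map swap_letter (rev ss)) (\<lambda>\<eta>. of_bool (Q (inv \<eta>))) id"
    unfolding S2_def using set_ss by (intro I2.measure_select_words_first) auto
  \<comment> \<open>Process 2 performs cells and then swaps, process 1 swaps and then cells; with
    both lists reversed the concatenations are mirror images.\<close>
  also have "map I2.cell_letter [0..<cell_count T N] @ map swap_letter (rev ss) =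
      rev (map swap_letter ss @ map I1.cell_letter [0..<cell_count T N])"
    unfolding cell_letter_reflected[OF I1.cells_axioms I2.cells_axioms] rev_append rev_map by (rule refl)
  also have "(\<lambda>\<eta>. of_bool (Q (inv \<eta>))) = (\<lambda>\<eta>. of_bool (Q \<eta>)) \<circ> inv"
    by (simp add: fun_eq_iff)
  also have "foldr (opR q {lo..<hi}) (rev (map swap_letter ss @ map I1.cell_letter [0..<cell_count T N]))
      ((\<lambda>\<eta>. of_bool (Q \<eta>)) \<circ> inv) id = measure M1 S1"
    unfolding S1_def foldr_opR_rev by (rule I1.measure_select_coins_first[OF refl set_ss, symmetric])
  finally have S: "measure M1 S1 = measure M2 S2" ..
  have A1: "\<bar>measure M1 ?A1 - measure M1 S1\<bar> \<le>
      (1 - measure M1 (I1.separated K m)) + (1 - measure M1 (I1.select (\<lambda>_ _. True)))"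
    unfolding S1_def
  proof (rule I1.measure_approx_select)
    show "?A1 \<in> sets M1" by (rule sets_cylinder[OF I1.measurable_process1[OF refl] J(1)])
    fix \<omega> x and c :: "bool list"
    assume *: "\<omega> \<in> I1.separated K m" "x \<in> words {lo..<hi} (cell_count T N)" "length c = length ss"
      "\<omega> \<in> I1.cell_event x c"
    have "process1 q T ss P1 U1 \<omega> y = run_word (decode x) (run_word (zip ss c) id) y" if "y \<in> J" for y
      by (rule I1.process1_eq_word[OF K lo_def hi_def *(1,2,4) refl *(3)]) (use that J in blast)
    moreover have "\<omega> \<in> space M1" using *(1) by (simp add: I1.separated_def)
    ultimately show "\<omega> \<in> ?A1 \<longleftrightarrow> Q (run_word (decode x) (run_word (zip ss c) id))"
      by (simp add: Q_def)
  qed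
  have A2: "\<bar>measure M2 ?A2 - measure M2 S2\<bar> \<le>
      (1 - measure M2 (I2.separated K m)) + (1 - measure M2 (I2.select (\<lambda>_ _. True)))"
    unfolding S2_def
  proof (rule I2.measure_approx_select)
    show "?A2 \<in> sets M2" by (rule sets_cylinder[OF I2.measurable_inv_process2[OF refl] J(1)])
    fix \<omega> x and c :: "bool list"
    assume *: "\<omega> \<in> I2.separated K m" "x \<in> words {lo..<hi} (cell_count T N)" "length c = length ss"
      "\<omega> \<in> I2.cell_event x c"
    have "inv (process2 q T ss P2 U2 \<omega>) y =
        inv (run_word (zip (rev ss) c) (run_word (decode x) id)) y" if "y \<in> J" for y
      by (rule I2.inv_process2_eq_word[OF K lo_def hi_def *(1,2,4) refl *(3) _ ss]) (use that J in blast)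
    moreover have "\<omega> \<in> space M2" using *(1) by (simp add: I2.separated_def)
    ultimately show "\<omega> \<in> ?A2 \<longleftrightarrow> Q (inv (run_word (zip (rev ss) c) (run_word (decode x) id)))"
      by (simp add: Q_def)
  qed
  have "1 - measure M1 (I1.select (\<lambda>_ _. True)) \<le> ?err"
    using I1.prob_select_all[of "C / real N"] I1.mass_time_cell_le[OF N] unfolding lo_def hi_def by blast
  moreover have "1 - measure M2 (I2.select (\<lambda>_ _. True)) \<le> ?err"
    using I2.prob_select_all[of "C / real N"] I1.mass_time_cell_le[OF N]
    unfolding lo_def hi_def mass_reflected_cell by blast
  ultimately show ?thesis
    by (intro abs_diff_le_of_common[OF A1 A2[folded S]] I1.prob_not_separated I2.prob_not_separated)
qed

lemma cylinder_eq:
  assumes q: "0 \<le> q" "q \<le> 1"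
    and B1: "bounded_clocks M1 T C r P1 (length ss) U1"
    and B2: "bounded_clocks M2 T C (\<lambda>z u. r z (T - u)) P2 (length ss) U2"
    and J: "finite J"
  shows "measure M1 {\<omega> \<in> space M1. \<forall>y\<in>J. process1 q T ss P1 U1 \<omega> y \<in> A y} =
      measure M2 {\<omega> \<in> space M2. \<forall>y\<in>J. inv (process2 q T ss P2 U2 \<omega>) y \<in> A y}"
    (is "?p1 = ?p2")
proof -
  interpret B1: bounded_clocks M1 T C r P1 "length ss" U1 by fact
  \<comment> \<open>One more than all absolute values, so that both sites of every swap lie in {-
    K..K}; the inserted 0 covers empty sets.\<close>
  define K where "K = Max (insert 0 (abs ` (J \<union> set ss))) + 1"
  have bound: "\<bar>v\<bar> \<le> K - 1" if "v \<in> J \<union> set ss" for v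
    using that J unfolding K_def by (auto intro!: Max_ge)
  have K: "0 \<le> K" using J unfolding K_def by (smt (verit) Max_ge finite_imageI finite_Un finite_set finite_insert insertI1)
  have J_sub: "J \<subseteq> {- K..K}" using bound by fastforce
  have ss: "- K \<le> s \<and> s < K" if "s \<in> set ss" for s using bound[of s] that by auto
  define \<rho> where "\<rho> = 1 - exp (- C * T)"
  have \<rho>: "0 \<le> \<rho>" "\<rho> < 1"
    using B1.C_nonneg B1.T by (auto simp: \<rho>_def)
  \<comment> \<open>The constant c grows with the window, so N tends to infinity for fixed m first;
    only then is m sent to infinity, using \<rho> < 1.\<close>
  have m_bound: "\<bar>?p1 - ?p2\<bar> \<le> 4 * \<rho> ^ m" for m
  proof -
    define c where "c = real (card {- K - int m..<K + int m}) * C"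
    have N_bound: "\<bar>?p1 - ?p2\<bar> \<le> 4 * \<rho> ^ m + (2 * (T + 1) * c\<^sup>2) / real N" if N: "0 < N" for N :: nat
    proof -
      \<comment> \<open>At most \<open>N * (T + 1)\<close> cells with an error of
        \<open>(c / N)\<^sup>2\<close> each leave a total of order 1 / N.\<close>
      have "real (cell_count T N) \<le> real N * T + 1"
        using B1.T by (simp add: cell_count_def)
      also have "\<dots> \<le> real N * (T + 1)" using N by (simp add: distrib_left)
      finally have "real (cell_count T N) * (c / real N)\<^sup>2 \<le> real N * (T + 1) * (c / real N)\<^sup>2"
        by (intro mult_right_mono) auto
      also have "\<dots> = (T + 1) * c\<^sup>2 / real N" using N by (simp add: power2_eq_square field_simps)
      finally have "real (cell_count T N) * (c / real N)\<^sup>2 \<le> (T + 1) * c\<^sup>2 / real N" .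
      moreover have "\<bar>?p1 - ?p2\<bar> \<le> 2 * (2 * \<rho> ^ m) + 2 * (real (cell_count T N) * (c / real N)\<^sup>2)"
        using cylinder_estimate[OF q B1 B2 J J_sub ss K N, of A m]
        unfolding \<rho>_def c_def times_divide_eq_right .
      moreover have "(2 * (T + 1) * c\<^sup>2) / real N = 2 * ((T + 1) * c\<^sup>2 / real N)" by simp
      ultimately show ?thesis by linarith
    qed
    have "(\<lambda>N. 4 * \<rho> ^ m + (2 * (T + 1) * c\<^sup>2) / real N) \<longlonglongrightarrow> 4 * \<rho> ^ m + 0"
      by (intro tendsto_add tendsto_const lim_const_over_n)
    then have "\<bar>?p1 - ?p2\<bar> \<le> 4 * \<rho> ^ m + 0"
      by (rule LIMSEQ_le_const) (use N_bound in \<open>auto intro!: exI[of _ 1]\<close>)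
    then show ?thesis by simp
  qed
  have "(\<lambda>m. 4 * \<rho> ^ m) \<longlonglongrightarrow> 4 * 0"
    using \<rho> by (intro tendsto_mult tendsto_const LIMSEQ_realpow_zero)
  then have "\<bar>?p1 - ?p2\<bar> \<le> 4 * 0"
    by (rule LIMSEQ_le_const) (use m_bound in blast)
  then show ?thesis by simp
qed

theorem theorem3p1:
  fixes q C t :: real and r :: "int \<Rightarrow> real \<Rightarrow> real" and ss :: "int list"
    and M1 :: "'a measure" and P1 :: "int \<Rightarrow> 'a \<Rightarrow> (real \<times> real) set" and U1 :: "nat \<Rightarrow> 'a \<Rightarrow> real"
    and M2 :: "'b measure" and P2 :: "int \<Rightarrow> 'b \<Rightarrow> (real \<times> real) set" and U2 :: "nat \<Rightarrow> 'b \<Rightarrow> real"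
  assumes "0 \<le> q" and "q \<le> 1"
    and "\<forall>z. \<forall>u\<ge>0. 0 \<le> r z u \<and> r z u \<le> C"
    and "\<forall>z. piecewise_continuous (r z)"
    and "0 \<le> t"
    and "poisson_family M1 t r P1 (length ss) U1"
    and "poisson_family M2 t (\<lambda>z u. r z (t - u)) P2 (length ss) U2"
  shows "(AE \<omega> in M1. bij (process1 q t ss P1 U1 \<omega>))
       \<and> (AE \<omega> in M2. bij (process2 q t ss P2 U2 \<omega>))
       \<and> process1 q t ss P1 U1 \<in> M1 \<rightarrow>\<^sub>M config_space
       \<and> (\<lambda>\<omega>. inv (process2 q t ss P2 U2 \<omega>)) \<in> M2 \<rightarrow>\<^sub>M config_space
       \<and> distr M1 config_space (process1 q t ss P1 U1)
         = distr M2 config_space (\<lambda>\<omega>. inv (process2 q t ss P2 U2 \<omega>))"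
proof -
  have rate: "rate_bound t C r" by (rule rate_bound_forward) fact+
  have B1: "bounded_clocks M1 t C r P1 (length ss) U1"
    by (intro bounded_clocks.intro clocks.intro rate) fact
  have B2: "bounded_clocks M2 t C (\<lambda>z u. r z (t - u)) P2 (length ss) U2"
    by (intro bounded_clocks.intro clocks.intro rate_bound_reflect rate) fact
  interpret B1: bounded_clocks M1 t C r P1 "length ss" U1 by fact
  interpret B2: bounded_clocks M2 t C "\<lambda>z u. r z (t - u)" P2 "length ss" U2 by fact
  have "distr M1 config_space (process1 q t ss P1 U1) =
      distr M2 config_space (\<lambda>\<omega>. inv (process2 q t ss P2 U2 \<omega>))"
    by (rule distr_config_space_eqI[OF B1.prob_space_axioms B2.prob_space_axioms
          B1.measurable_process1[OF refl] B2.measurable_inv_process2[OF refl]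
          cylinder_eq[OF assms(1,2) B1 B2]])
  then show ?thesis
    using B1.bij_process1[OF refl] B2.bij_process2[OF refl]
      B1.measurable_process1[OF refl] B2.measurable_inv_process2[OF refl]
    by (intro conjI AE_I2) auto
qed

end
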